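(* Let $d \geq 2$ and $n \geq 1$ be integers, let $K$ be an infinite field of characteristic $p$, let $R = K[x_0, \ldots, x_n]$, and let $I = (x_0^d, \ldots, x_n^d) \subset R$. Then $R/I$ has the strong Lefschetz property if and only if $p$ is zero, or $p$ is a positive prime and either (i) $n = 1$ and $p^s > 2(d-1)$, where $s$ is the largest integer such that $p^{s-1}$ divides $(2d-1)(2d+1)$, or (ii) $n \geq 2$ and $p > (n+1)(d-1)$.
   Context: $R$ is standard graded and $[A]_d$ denotes the degree $d$ component of a graded algebra $A$. An artinian standard graded $K$-algebra $A = R/I$ has the strong Lefschetz property if there exists a linear form $\ell \in A$ such that for all integers $d$ and all $k \geq 1$ the multiplication map $\times \ell^k : [A]_d \rightarrow [A]_{d+k}$ has maximal rank (i.e. is injective or surjective). *)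

theory Defs
  imports
    "HOL-Library.Poly_Mapping"
    "HOL-Computational_Algebra.Polynomial"
    "HOL-Computational_Algebra.Primes"
    "HOL-Algebra.QuotRing"
begin

text \<open>
  A polynomial over \<open>'k\<close> is a finitely supported map from exponent vectors
  \<open>nat \<Rightarrow>\<^sub>0 nat\<close> to coefficients; multiplication on \<open>\<Rightarrow>\<^sub>0\<close> is convolution.
\<close>

type_synonym 'k mpoly = "(nat \<Rightarrow>\<^sub>0 nat) \<Rightarrow>\<^sub>0 'k"

definition Var :: "nat \<Rightarrow> 'k::field mpoly" where
  "Var i = Poly_Mapping.single (Poly_Mapping.single i 1) 1"

definition monom_deg :: "(nat \<Rightarrow>\<^sub>0 nat) \<Rightarrow> nat" where
  "monom_deg m = (\<Sum>i\<in>Poly_Mapping.keys m. Poly_Mapping.lookup m i)"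

text \<open>\<open>poly_ring n\<close> is $K[x_0, \ldots, x_n]$, in the $n + 1$ variables \<open>Var 0, \<dots>, Var n\<close>.\<close>

definition poly_ring :: "nat \<Rightarrow> 'k::field mpoly ring" where
  "poly_ring n =
    \<lparr>carrier = {f. \<forall>m\<in>Poly_Mapping.keys f. Poly_Mapping.keys m \<subseteq> {0..n}},
     mult = (*), one = 1, zero = 0, add = (+)\<rparr>"

text \<open>Degrees are integers; in negative degrees the only homogeneous polynomial is \<open>0\<close>.\<close>

definition homogeneous :: "nat \<Rightarrow> int \<Rightarrow> 'k::field mpoly set" where
  "homogeneous n e =
    {f \<in> carrier (poly_ring n). \<forall>m\<in>Poly_Mapping.keys f. int (monom_deg m) = e}"

text \<open>
  The component $[R/I]_e$ of the quotient of $R = K[x_0, \ldots, x_n]$ by a homogeneous ideal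
  \<open>I\<close> is the image of $[R]_e$; its elements are cosets.
\<close>

definition quot_component :: "nat \<Rightarrow> 'k::field mpoly set \<Rightarrow> int \<Rightarrow> 'k mpoly set set" where
  "quot_component n I e = (\<lambda>f. I +>\<^bsub>poly_ring n\<^esub> f) ` homogeneous n e"

text \<open>
  The strong Lefschetz property of $A = R/I$, meant for homogeneous ideals \<open>I\<close> with \<open>A\<close> artinian.
  Maximal rank of $\times \ell^k : [A]_e \to [A]_{e+k}$ means injective or surjective.
\<close>

definition strong_lefschetz :: "nat \<Rightarrow> 'k::field mpoly set \<Rightarrow> bool" where
  "strong_lefschetz n I \<longleftrightarrow>
    (let A = poly_ring n Quot I in
     \<exists>l \<in> quot_component n I 1. \<forall>e::int. \<forall>k::nat. k \<ge> 1 \<longrightarrow>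
       inj_on (\<lambda>a. l [^]\<^bsub>A\<^esub> k \<otimes>\<^bsub>A\<^esub> a) (quot_component n I e) \<or>
       (\<lambda>a. l [^]\<^bsub>A\<^esub> k \<otimes>\<^bsub>A\<^esub> a) ` quot_component n I e = quot_component n I (e + int k))"

definition monomial_ci :: "nat \<Rightarrow> nat \<Rightarrow> 'k::field mpoly set" where
  "monomial_ci n d = Idl\<^bsub>poly_ring n\<^esub> {Var i ^ d | i. i \<in> {0..n}}"

end

theory Submission
  imports Defs
begin

text \<open>
  Write \<open>t = (n + 1) (d - 1)\<close> for the socle degree of \<open>A = R/I\<close>. By the socle pairing and
  induction on the degree, \<open>\<ell>\<close> is a Lefschetz element as soon as, for \<open>2 e \<le> t\<close>, the kernel of
  \<open>\<ell>\<close> in degree \<open>t - e\<close> lies in the image of \<open>\<ell>\<^sup>t\<^sup>-\<^sup>2\<^sup>e\<close>.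

  If \<open>p = 0\<close> or \<open>p > t\<close>, this follows for \<open>\<ell> = x\<^sub>0 + \<cdots> + x\<^sub>n\<close> from an \<open>sl\<^sub>2\<close>-action:
  with \<open>F\<close> the lowering operator, \<open>\<ell>\<^sup>N F\<^sup>N h = (N!)\<^sup>2 h\<close> for \<open>h\<close> killed by \<open>\<ell>\<close>, \<open>N = t - 2 e\<close>.

  For \<open>n = 1\<close> that kernel is spanned by one explicit form. Over the rationals its preimage under
  \<open>\<ell>\<^sup>2\<^sup>m\<close>, \<open>m = d - 1 - e\<close>, has the coefficients
  \<open>\<plusminus> C(m + i, m) C(m + e - i, m) / C(2 m, m)\<close>, and by Legendre's formula these are \<open>p\<close>-integral when
  every power \<open>q \<le> 2 (d - 1)\<close> of \<open>p\<close> divides \<open>2 d - 1\<close> or \<open>2 d + 1\<close>.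

  Conversely, for a power \<open>q\<close> of \<open>p\<close>, the form \<open>\<ell>\<^sup>q\<close> is a linear form in the \<open>x\<^sub>i\<^sup>q\<close>, so \<open>A\<close>
  splits into shifted copies of monomial complete intersections in the \<open>x\<^sub>i\<^sup>q\<close>. When the shifts
  vary by at least \<open>q\<close>, some power of \<open>\<ell>\<^sup>q\<close> is neither injective nor surjective.
\<close>

abbreviation keys :: "('a \<Rightarrow>\<^sub>0 'b::zero) \<Rightarrow> 'a set"
  where "keys \<equiv> Poly_Mapping.keys"

abbreviation lookup :: "('a \<Rightarrow>\<^sub>0 'b::zero) \<Rightarrow> 'a \<Rightarrow> 'b"
  where "lookup \<equiv> Poly_Mapping.lookup"

abbreviation single :: "'a \<Rightarrow> 'b \<Rightarrow> ('a \<Rightarrow>\<^sub>0 'b::zero)"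
  where "single \<equiv> Poly_Mapping.single"

section \<open>Monomials and the ideal\<close>

definition exponents :: "nat \<Rightarrow> (nat \<Rightarrow>\<^sub>0 nat) set" where
  "exponents n = {m. keys m \<subseteq> {0..n}}"

lemma exponents_add: "a \<in> exponents n \<Longrightarrow> b \<in> exponents n \<Longrightarrow> a + b \<in> exponents n"
  unfolding exponents_def using keys_add[of a b] by auto

lemma exponents_zero [simp]: "0 \<in> exponents n"
  by (simp add: exponents_def)

lemma exponents_single: "i \<le> n \<Longrightarrow> single i k \<in> exponents n"
  by (simp add: exponents_def)

lemma exponents_lookup: "m \<in> exponents n \<Longrightarrow> n < i \<Longrightarrow> lookup m i = 0"
  unfolding exponents_def by (metis CollectD atLeastAtMost_iff in_keys_iff not_less subsetD)

lemma exponents_eqI: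
  assumes "a \<in> exponents n" "b \<in> exponents n" "\<And>i. i \<le> n \<Longrightarrow> lookup a i = lookup b i"
  shows "a = b"
  by (rule poly_mapping_eqI) (metis assms exponents_lookup not_less)

lemma monom_deg_eq:
  assumes "m \<in> exponents n"
  shows "monom_deg m = (\<Sum>i\<le>n. lookup m i)"
  unfolding monom_deg_def using assms
  by (intro sum.mono_neutral_left) (auto simp: exponents_def in_keys_iff)

lemma monom_deg_add:
  assumes "a \<in> exponents n" "b \<in> exponents n"
  shows "monom_deg (a + b) = monom_deg a + monom_deg b"
  using assms by (simp add: monom_deg_eq[where n = n] exponents_add lookup_add sum.distrib)

lemma monom_deg_single [simp]: "monom_deg (single i k) = k"
  by (simp add: monom_deg_def)

lemma monom_deg_zero [simp]: "monom_deg 0 = 0"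
  by (simp add: monom_deg_def)

definition exponent_of :: "nat \<Rightarrow> (nat \<Rightarrow> nat) \<Rightarrow> nat \<Rightarrow>\<^sub>0 nat" where
  "exponent_of n g = (\<Sum>i\<le>n. single i (g i))"

lemma lookup_exponent_of: "lookup (exponent_of n g) i = (if i \<le> n then g i else 0)"
  by (auto simp: exponent_of_def lookup_sum lookup_single when_def)

lemma exponent_of_in [simp]: "exponent_of n g \<in> exponents n"
  by (auto simp: exponents_def in_keys_iff lookup_exponent_of split: if_splits)

lemma monom_deg_exponent_of: "monom_deg (exponent_of n g) = (\<Sum>i\<le>n. g i)"
  by (subst monom_deg_eq[OF exponent_of_in]) (simp add: lookup_exponent_of)

lemma poly_mapping_sum_single: "f = (\<Sum>m\<in>keys f. single m (lookup f m))"
  by (rule poly_mapping_eqI) (auto simp: lookup_sum lookup_single when_def in_keys_iff)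

lemma Var_power: "(Var i :: 'k::field mpoly) ^ k = single (single i k) 1"
  by (induction k) (auto simp: Var_def mult_single single_add[symmetric] add.commute)

lemma keys_timesD: "m \<in> keys (f * g) \<Longrightarrow> \<exists>a\<in>keys f. \<exists>b\<in>keys g. m = a + b"
  using keys_mult[of f g] by blast

lemma keys_plusD: "m \<in> keys (f + g) \<Longrightarrow> m \<in> keys f \<or> m \<in> keys g"
  using keys_add[of f g] by blast

text \<open>Translation by \<open>b\<close> is injective on exponent vectors, so exactly one term of
  \<open>f\<close> lands on \<open>a + b\<close>.\<close>

lemma lookup_mult_single:
  "lookup (f * single b (c :: 'k::field)) (a + b) = lookup f a * c" for b :: "nat \<Rightarrow>\<^sub>0 nat"
proof -
  have "f * single b c = (\<Sum>m\<in>keys f. single (m + b) (lookup f m * c))"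
    by (subst poly_mapping_sum_single[of f]) (simp add: sum_distrib_right mult_single)
  also have "lookup \<dots> (a + b) = (\<Sum>m\<in>keys f. if m = a then lookup f m * c else 0)"
    by (auto simp: lookup_sum lookup_single when_def intro!: sum.cong)
  also have "\<dots> = lookup f a * c"
    by (simp add: in_keys_iff)
  finally show ?thesis .
qed

section \<open>The polynomial ring as a commutative ring\<close>

lemma carrier_poly_ring: "carrier (poly_ring n) = {f. keys f \<subseteq> exponents n}"
  by (auto simp: poly_ring_def exponents_def)

lemma poly_ring_simps [simp]:
  "mult (poly_ring n) = (*)" "one (poly_ring n) = 1"
  "zero (poly_ring n) = 0" "add (poly_ring n) = (+)"
  by (simp_all add: poly_ring_def)

lemma carrier_closed:
  assumes "f \<in> carrier (poly_ring n)" "g \<in> carrier (poly_ring n)"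
  shows "f + g \<in> carrier (poly_ring n)" "f * g \<in> carrier (poly_ring n)"
    "f - g \<in> carrier (poly_ring n)" "- f \<in> carrier (poly_ring n)"
proof -
  show "f + g \<in> carrier (poly_ring n)"
    using assms keys_add[of f g] by (auto simp: carrier_poly_ring)
  show "f * g \<in> carrier (poly_ring n)"
    using assms by (auto simp: carrier_poly_ring intro!: exponents_add dest!: keys_timesD)
  show "f - g \<in> carrier (poly_ring n)"
    using assms keys_diff[of f g] by (auto simp: carrier_poly_ring)
  show "- f \<in> carrier (poly_ring n)"
    using assms by (auto simp: carrier_poly_ring)
qed

lemma poly_ring_cring: "cring (poly_ring n :: 'k::field mpoly ring)"
proof (rule cringI)
  show "abelian_group (poly_ring n :: 'k mpoly ring)"
  proof (rule abelian_groupI)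
    fix x :: "'k mpoly" assume "x \<in> carrier (poly_ring n)"
    then show "\<exists>y\<in>carrier (poly_ring n). y \<oplus>\<^bsub>poly_ring n\<^esub> x = \<zero>\<^bsub>poly_ring n\<^esub>"
      by (intro bexI[of _ "- x"]) (auto intro: carrier_closed)
  qed (auto simp: carrier_closed carrier_poly_ring[of n] add_ac dest!: keys_plusD)
  show "comm_monoid (poly_ring n :: 'k mpoly ring)"
    by (rule comm_monoidI) (auto simp: mult_ac carrier_poly_ring[of n] intro!: exponents_add dest!: keys_timesD)
qed (auto simp: algebra_simps)

lemma poly_ring_a_minus:
  assumes "f \<in> carrier (poly_ring n)" "g \<in> carrier (poly_ring n :: 'k::field mpoly ring)"
  shows "f \<ominus>\<^bsub>poly_ring n\<^esub> g = f - g"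
proof -
  interpret cring "poly_ring n :: 'k mpoly ring" by (rule poly_ring_cring)
  have "\<ominus>\<^bsub>poly_ring n\<^esub> g = - g"
    by (rule minus_equality) (use assms in \<open>auto intro: carrier_closed\<close>)
  then show ?thesis
    by (simp add: a_minus_def)
qed

section \<open>The ideal generated by the powers of the variables\<close>

definition large_exponents :: "nat \<Rightarrow> nat \<Rightarrow> (nat \<Rightarrow>\<^sub>0 nat) set" where
  "large_exponents n d = {m \<in> exponents n. \<exists>i\<le>n. d \<le> lookup m i}"

lemma large_exponents_add:
  "a \<in> large_exponents n d \<Longrightarrow> b \<in> exponents n \<Longrightarrow> a + b \<in> large_exponents n d"
  "b \<in> large_exponents n d \<Longrightarrow> a \<in> exponents n \<Longrightarrow> a + b \<in> large_exponents n d"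
  by (force simp: large_exponents_def exponents_add lookup_add)+

lemma monomial_ideal_is_ideal:
  "ideal {f. keys f \<subseteq> large_exponents n d} (poly_ring n :: 'k::field mpoly ring)"
    (is "ideal ?J _")
proof (rule idealI)
  interpret cring "poly_ring n :: 'k mpoly ring" by (rule poly_ring_cring)
  show "ring (poly_ring n :: 'k mpoly ring)" ..
  have sub: "large_exponents n d \<subseteq> exponents n"
    by (auto simp: large_exponents_def)
  show "subgroup ?J (add_monoid (poly_ring n :: 'k mpoly ring))"
  proof (rule add.subgroupI)
    show "?J \<subseteq> carrier (poly_ring n)"
      using sub by (auto simp: carrier_poly_ring)
    show "?J \<noteq> {}"
      by (auto intro!: exI[of _ 0])
  next
    fix a assume a: "a \<in> ?J"
    then have "a \<in> carrier (poly_ring n)"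
      using sub by (auto simp: carrier_poly_ring)
    then have "\<ominus>\<^bsub>poly_ring n\<^esub> a = - a"
      by (intro minus_equality) (auto intro: carrier_closed)
    with a show "\<ominus>\<^bsub>poly_ring n\<^esub> a \<in> ?J"
      by simp
  next
    fix a b assume "a \<in> ?J" "b \<in> ?J"
    then show "a \<oplus>\<^bsub>poly_ring n\<^esub> b \<in> ?J"
      using keys_add[of a b] by auto
  qed
  fix a x :: "'k mpoly" assume "a \<in> ?J" "x \<in> carrier (poly_ring n)"
  then show "x \<otimes>\<^bsub>poly_ring n\<^esub> a \<in> ?J" "a \<otimes>\<^bsub>poly_ring n\<^esub> x \<in> ?J"
    by (auto simp: carrier_poly_ring dest!: keys_timesD
        intro: large_exponents_add(1) large_exponents_add(2))
qed

text \<open>The right-hand side is an ideal containing every generator, and each of its monomials is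
  a multiple of some generator. Membership in the ideal thus becomes a condition on the support, and
  this is how it is tested from here on.\<close>

lemma monomial_ci_eq:
  "(monomial_ci n d :: 'k::field mpoly set) = {f. keys f \<subseteq> large_exponents n d}"
    (is "_ = ?J")
proof
  interpret cring "poly_ring n :: 'k mpoly ring" by (rule poly_ring_cring)
  have gens: "{Var i ^ d |i. i \<in> {0..n}} \<subseteq> (carrier (poly_ring n) :: 'k mpoly set)"
    by (auto simp: Var_power carrier_poly_ring exponents_single)
  show "(monomial_ci n d :: 'k mpoly set) \<subseteq> ?J"
  proof -
    have "Var i ^ d \<in> ?J" if "i \<le> n" for i
      using that lookup_single_eq[of i d] exponents_single[of i n d]
      by (auto simp: Var_power large_exponents_def)
    then have "{Var i ^ d |i. i \<in> {0..n}} \<subseteq> ?J"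
      by (force simp only: atLeastAtMost_iff)
    from genideal_minimal[OF monomial_ideal_is_ideal this] show ?thesis
      by (simp only: monomial_ci_def)
  qed
  show "?J \<subseteq> (monomial_ci n d :: 'k mpoly set)"
  proof
    fix f :: "'k mpoly" assume f: "f \<in> ?J"
    interpret I: ideal "monomial_ci n d :: 'k mpoly set" "poly_ring n"
      unfolding monomial_ci_def by (rule genideal_ideal[OF gens])
    have single_in: "single m c \<in> monomial_ci n d" if large: "m \<in> large_exponents n d" for m and c :: 'k
    proof -
      obtain i where i: "i \<le> n" "d \<le> lookup m i"
        and m: "m \<in> exponents n"
        using large by (auto simp: large_exponents_def)
      \<comment> \<open>The cofactor of \<open>Var i ^ d\<close> in the monomial \<open>m\<close>;
        truncated subtraction is exact because \<open>d \<le> lookup m i\<close>.\<close>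
      define m' where "m' = m - single i d"
      have m': "m = m' + single i d"
        by (rule poly_mapping_eqI)
          (use i in \<open>auto simp: m'_def lookup_add lookup_minus lookup_single when_def\<close>)
      have "keys m' \<subseteq> keys m"
        by (auto simp: m'_def in_keys_iff lookup_minus)
      then have "m' \<in> exponents n"
        using m by (auto simp: exponents_def)
      then have "single m' c \<in> carrier (poly_ring n)"
        by (auto simp: carrier_poly_ring)
      moreover have "(Var i :: 'k mpoly) ^ d \<in> monomial_ci n d"
        unfolding monomial_ci_def using i by (intro subsetD[OF genideal_self[OF gens]]) auto
      ultimately have "single m' c * Var i ^ d \<in> monomial_ci n d"
        using I.I_l_closed by fastforce
      then show ?thesis
        by (simp add: Var_power mult_single m')
    qed
    have "(\<Sum>m\<in>S. single m (lookup f m)) \<in> monomial_ci n d"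
      if "finite S" "S \<subseteq> large_exponents n d" for S
      using that
    proof (induction S)
      case empty
      then show ?case
        using I.zero_closed by simp
    next
      case (insert x F)
      then show ?case
        using I.a_closed single_in by fastforce
    qed
    from this[of "keys f"] show "f \<in> monomial_ci n d"
      using f poly_mapping_sum_single[of f] by simp
  qed
qed

lemma monomial_ci_ideal: "ideal (monomial_ci n d) (poly_ring n :: 'k::field mpoly ring)"
  unfolding monomial_ci_eq by (rule monomial_ideal_is_ideal)

lemma monomial_ci_closed:
  fixes f g h :: "'k::field mpoly"
  assumes f: "f \<in> monomial_ci n d"
  shows "g \<in> monomial_ci n d \<Longrightarrow> f + g \<in> monomial_ci n d"
    "g \<in> monomial_ci n d \<Longrightarrow> f - g \<in> monomial_ci n d"
    "- f \<in> monomial_ci n d"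
    "h \<in> carrier (poly_ring n) \<Longrightarrow> h * f \<in> monomial_ci n d"
    "h \<in> carrier (poly_ring n) \<Longrightarrow> f * h \<in> monomial_ci n d"
  using f keys_add[of f g] keys_diff[of f g]
  by (auto simp: monomial_ci_eq carrier_poly_ring dest!: keys_timesD
      intro: large_exponents_add(1) large_exponents_add(2))

lemma monomial_ci_zero [simp]: "0 \<in> monomial_ci n d"
  by (simp add: monomial_ci_eq)

section \<open>Reformulation of the strong Lefschetz property\<close>

lemma homogeneous_eq:
  "homogeneous n e = {f. keys f \<subseteq> {m \<in> exponents n. int (monom_deg m) = e}}"
  by (auto simp: homogeneous_def carrier_poly_ring)

lemma homogeneous_carrier: "f \<in> homogeneous n e \<Longrightarrow> f \<in> carrier (poly_ring n)"
  by (simp add: homogeneous_def)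

lemma homogeneous_closed:
  assumes "f \<in> homogeneous n e" "g \<in> homogeneous n e"
  shows "f + g \<in> homogeneous n e" "f - g \<in> homogeneous n e"
  using assms keys_add[of f g] keys_diff[of f g] by (auto simp: homogeneous_eq)

lemma homogeneous_zero [simp]: "0 \<in> homogeneous n e"
  by (simp add: homogeneous_eq)

lemma homogeneous_times:
  assumes "f \<in> homogeneous n e" "g \<in> homogeneous n e'"
  shows "f * g \<in> homogeneous n (e + e')"
  using assms unfolding homogeneous_eq
  by (auto dest!: keys_timesD subsetD simp: exponents_add monom_deg_add)

lemma homogeneous_one: "1 \<in> homogeneous n 0"
  by (simp add: homogeneous_eq)

lemma homogeneous_power:
  assumes "f \<in> homogeneous n e"
  shows "f ^ k \<in> homogeneous n (int k * e)"
  using assms by (induction k) (auto simp: homogeneous_one algebra_simps intro: homogeneous_times)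

lemma homogeneous_sum:
  "(\<And>i. i \<in> S \<Longrightarrow> f i \<in> homogeneous n e) \<Longrightarrow> sum f S \<in> homogeneous n e"
  by (induction S rule: infinite_finite_induct) (auto intro: homogeneous_closed)

lemma homogeneous_negative: "e < 0 \<Longrightarrow> f \<in> homogeneous n e \<Longrightarrow> f = 0"
  by (auto simp: homogeneous_eq simp flip: keys_eq_empty)

text \<open>Pigeonhole: \<open>n + 1\<close> exponents below \<open>d\<close> have sum at most the
  socle degree, so a larger degree forces some exponent to reach \<open>d\<close>.\<close>

lemma homogeneous_high_degree:
  fixes f :: "'k::field mpoly"
  assumes "f \<in> homogeneous n e" "e > int ((n + 1) * (d - 1))"
  shows "f \<in> monomial_ci n d"
proof -
  have "\<exists>i\<le>n. d \<le> lookup m i" if "m \<in> exponents n" "int (monom_deg m) = e" for m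
  proof (rule ccontr)
    assume "\<not> (\<exists>i\<le>n. d \<le> lookup m i)"
    then have "lookup m i \<le> d - 1" if "i \<le> n" for i
      using that by force
    then have "(\<Sum>i\<le>n. lookup m i) \<le> (\<Sum>i\<le>n. d - 1)"
      by (intro sum_mono) auto
    then have "monom_deg m \<le> (n + 1) * (d - 1)"
      using that by (simp add: monom_deg_eq)
    with that assms show False
      by linarith
  qed
  then show ?thesis
    using assms by (auto simp: homogeneous_eq monomial_ci_eq large_exponents_def)
qed

text \<open>Maximal rank phrased on polynomial representatives: injectivity as a kernel contained in
  the ideal, surjectivity as a congruence modulo the ideal.\<close>

definition lefschetz_element :: "nat \<Rightarrow> nat \<Rightarrow> 'k::field mpoly \<Rightarrow> bool" where
  "lefschetz_element n d l \<longleftrightarrow> (\<forall>e::int. \<forall>k\<ge>1.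
     (\<forall>f\<in>homogeneous n e. l ^ k * f \<in> monomial_ci n d \<longrightarrow> f \<in> monomial_ci n d) \<or>
     (\<forall>h\<in>homogeneous n (e + int k). \<exists>f\<in>homogeneous n e. h - l ^ k * f \<in> monomial_ci n d))"

text \<open>Two cosets agree exactly when the representatives differ by an element of the ideal, and
  coset products are computed on representatives. As multiplication is additive, injectivity is the
  same as a trivial kernel. Later arguments can therefore avoid cosets.\<close>

lemma strong_lefschetz_iff:
  "strong_lefschetz n (monomial_ci n d :: 'k::field mpoly set) \<longleftrightarrow>
     (\<exists>l\<in>homogeneous n 1. lefschetz_element n d (l :: 'k mpoly))"
proof -
  let ?R = "poly_ring n :: 'k mpoly ring"
  let ?I = "monomial_ci n d :: 'k mpoly set"
  let ?A = "?R Quot ?I"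
  let ?c = "\<lambda>f. ?I +>\<^bsub>?R\<^esub> f"
  interpret R: cring ?R by (rule poly_ring_cring)
  interpret I: ideal ?I ?R by (rule monomial_ci_ideal)
  have eq: "?c f = ?c g \<longleftrightarrow> f - g \<in> ?I" if "f \<in> carrier ?R" "g \<in> carrier ?R" for f g
    using R.quotient_eq_iff_same_a_r_cos[OF I.is_ideal that] poly_ring_a_minus[OF that] by simp
  have mult: "?c f \<otimes>\<^bsub>?A\<^esub> ?c g = ?c (f * g)" if "f \<in> carrier ?R" "g \<in> carrier ?R" for f g
    using I.rcoset_mult_add[OF that] by (simp add: FactRing_def)
  have one: "\<one>\<^bsub>?A\<^esub> = ?c 1"
    by (simp add: FactRing_def)
  have pow_carrier: "l ^ k \<in> carrier ?R" if "l \<in> carrier ?R" for l k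
    using that R.one_closed by (induction k) (auto intro: carrier_closed)
  have pow: "?c l [^]\<^bsub>?A\<^esub> k = ?c (l ^ k)" if "l \<in> carrier ?R" for l and k :: nat
    by (induction k) (auto simp: one mult pow_carrier that nat_pow_def mult.commute)
  have inj: "inj_on (\<lambda>a. ?c l [^]\<^bsub>?A\<^esub> k \<otimes>\<^bsub>?A\<^esub> a) (quot_component n ?I e) \<longleftrightarrow>
      (\<forall>f\<in>homogeneous n e. l ^ k * f \<in> ?I \<longrightarrow> f \<in> ?I)" (is "?L \<longleftrightarrow> ?P")
    if l: "l \<in> carrier ?R" for l e and k :: nat
  proof -
    have "?L \<longleftrightarrow> (\<forall>f\<in>homogeneous n e. \<forall>g\<in>homogeneous n e.
        l ^ k * (f - g) \<in> ?I \<longrightarrow> f - g \<in> ?I)"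
      unfolding inj_on_def quot_component_def
      by (simp add: pow[OF l] mult pow_carrier[OF l] homogeneous_carrier eq carrier_closed
          right_diff_distrib)
    also have "\<dots> \<longleftrightarrow> ?P"
      by (metis diff_zero homogeneous_closed(2) homogeneous_zero)
    finally show ?thesis .
  qed
  have surj: "(\<lambda>a. ?c l [^]\<^bsub>?A\<^esub> k \<otimes>\<^bsub>?A\<^esub> a) ` quot_component n ?I e =
        quot_component n ?I (e + int k) \<longleftrightarrow>
      (\<forall>h\<in>homogeneous n (e + int k). \<exists>f\<in>homogeneous n e. h - l ^ k * f \<in> ?I)" (is "?L \<longleftrightarrow> ?P")
    if l: "l \<in> homogeneous n 1" for l e and k :: nat
  proof -
    note lc = homogeneous_carrier[OF l]
    have img: "(\<lambda>a. ?c l [^]\<^bsub>?A\<^esub> k \<otimes>\<^bsub>?A\<^esub> a) ` quot_component n ?I e =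
        (\<lambda>f. ?c (l ^ k * f)) ` homogeneous n e"
      unfolding quot_component_def image_image
      by (intro image_cong) (auto simp: pow[OF lc] mult pow_carrier[OF lc] homogeneous_carrier)
    have "l ^ k * f \<in> homogeneous n (e + int k)" if "f \<in> homogeneous n e" for f
      using homogeneous_times[OF homogeneous_power[OF l, of k] that] by (simp add: add.commute)
    then have sub: "(\<lambda>f. ?c (l ^ k * f)) ` homogeneous n e \<subseteq> quot_component n ?I (e + int k)"
      unfolding quot_component_def by auto
    have "?L \<longleftrightarrow> quot_component n ?I (e + int k) \<subseteq> (\<lambda>f. ?c (l ^ k * f)) ` homogeneous n e"
      unfolding img using sub by auto
    also have "\<dots> \<longleftrightarrow> (\<forall>h\<in>homogeneous n (e + int k). \<exists>f\<in>homogeneous n e. ?c h = ?c (l ^ k * f))"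
      unfolding quot_component_def by auto
    also have "\<dots> \<longleftrightarrow> ?P"
      by (intro ball_cong bex_cong refl eq carrier_closed pow_carrier lc homogeneous_carrier)
    finally show ?thesis .
  qed
  have "strong_lefschetz n ?I \<longleftrightarrow> (\<exists>l\<in>homogeneous n 1. \<forall>e::int. \<forall>k::nat. k \<ge> 1 \<longrightarrow>
       inj_on (\<lambda>a. ?c l [^]\<^bsub>?A\<^esub> k \<otimes>\<^bsub>?A\<^esub> a) (quot_component n ?I e) \<or>
       (\<lambda>a. ?c l [^]\<^bsub>?A\<^esub> k \<otimes>\<^bsub>?A\<^esub> a) ` quot_component n ?I e = quot_component n ?I (e + int k))"
    unfolding strong_lefschetz_def Let_def by (subst (1) quot_component_def) blast
  also have "\<dots> \<longleftrightarrow> (\<exists>l\<in>homogeneous n 1. lefschetz_element n d (l :: 'k mpoly))"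
    unfolding lefschetz_element_def
    by (intro bex_cong refl) (simp add: inj[OF homogeneous_carrier] surj)
  finally show ?thesis .
qed

section \<open>A criterion for Lefschetz elements\<close>

text \<open>The hypothesis on the kernel makes \<open>l ^ (t - 2 * e)\<close> surjective from degree
  \<open>e\<close> to degree \<open>t - e\<close>, by induction on \<open>e\<close>. The socle
  pairing turns this into injectivity, and every other power of \<open>l\<close> is a factor of one
  of these bijections or has a zero source or target.\<close>

lemma lefschetz_criterion:
  fixes l :: "'k::field mpoly" and n d :: nat
  defines "t \<equiv> (n + 1) * (d - 1)"
  assumes d: "d \<ge> 1" and l: "l \<in> homogeneous n 1"
    and ker: "\<And>e h. 2 * e \<le> t \<Longrightarrow> h \<in> homogeneous n (int (t - e)) \<Longrightarrow> l * h \<in> monomial_ci n d \<Longrightarrow>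
      \<exists>f\<in>homogeneous n (int e). h - l ^ (t - 2 * e) * f \<in> monomial_ci n d"
  shows "lefschetz_element n d l"
proof -
  let ?I = "monomial_ci n d :: 'k mpoly set"
  have lpow: "l ^ k \<in> homogeneous n (int k)" for k
    using homogeneous_power[OF l, of k] by simp
  have lpow_times: "l ^ k * f \<in> homogeneous n (e + int k)" if "f \<in> homogeneous n e" for f k e
    using homogeneous_times[OF lpow that] by (simp add: add.commute)
  have surj: "\<exists>f\<in>homogeneous n (int e). h - l ^ (t - 2 * e) * f \<in> ?I"
    if "2 * e \<le> t" "h \<in> homogeneous n (int (t - e))" for e h
    using that
  proof (induction e arbitrary: h)
    case 0
    then have "l * h \<in> ?I"
      by (intro homogeneous_high_degree[of _ n "1 + int t"] homogeneous_times[OF l]) (auto simp: t_def)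
    with ker[of 0 h] 0 show ?case
      by auto
  next
    case (Suc e)
    have le: "2 * e \<le> t" "Suc e \<le> t"
      using Suc.prems by auto
    \<comment> \<open>Multiplying by \<open>l\<close> moves \<open>h\<close> up to degree
      \<open>t - e\<close>, where the induction hypothesis supplies a preimage \<open>g\<close>.
      Since \<open>t - 2 * e = N + 2\<close>, subtracting \<open>l ^ N * (l * g)\<close> from
      \<open>h\<close> leaves a form killed by \<open>l\<close>, to which \<open>ker\<close>
      applies.\<close>
    have "l * h \<in> homogeneous n (1 + int (t - Suc e))"
      by (intro homogeneous_times[OF l] Suc.prems)
    also have "1 + int (t - Suc e) = int (t - e)"
      using Suc.prems by simp
    finally obtain g where g: "g \<in> homogeneous n (int e)" "l * h - l ^ (t - 2 * e) * g \<in> ?I"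
      using Suc.IH[OF le(1)] by blast
    define N where "N = t - 2 * Suc e"
    have N: "t - 2 * e = Suc (Suc N)"
      using Suc.prems by (simp add: N_def)
    have lg: "l * g \<in> homogeneous n (int (Suc e))"
      using homogeneous_times[OF l g(1)] by (simp add: add.commute)
    have "l ^ N * (l * g) \<in> homogeneous n (int (Suc e) + int N)"
      by (rule lpow_times[OF lg])
    also have "int (Suc e) + int N = int (t - Suc e)"
      using Suc.prems by (simp add: N_def)
    finally have "h - l ^ N * (l * g) \<in> homogeneous n (int (t - Suc e))"
      using Suc.prems by (intro homogeneous_closed)
    moreover have "l * (h - l ^ N * (l * g)) \<in> ?I"
      using g(2) unfolding N by (simp add: algebra_simps)
    ultimately obtain f where f: "f \<in> homogeneous n (int (Suc e))"
        "h - l ^ N * (l * g) - l ^ N * f \<in> ?I"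
      using ker[of "Suc e"] Suc.prems by (auto simp: N_def)
    then show ?case
      using lg by (intro bexI[of _ "l * g + f"] homogeneous_closed) (auto simp: N_def algebra_simps)
  qed
  have inj: "f \<in> ?I"
    if e: "2 * e \<le> t" and f: "f \<in> homogeneous n (int e)" and lf: "l ^ (t - 2 * e) * f \<in> ?I" for e f
  proof (rule ccontr)
    assume "f \<notin> ?I"
    then obtain m where m: "m \<in> keys f" "m \<notin> large_exponents n d"
      by (auto simp: monomial_ci_eq)
    from m f have mexp: "m \<in> exponents n" and deg: "monom_deg m = e"
      by (auto simp: homogeneous_eq)
    have "\<forall>i\<le>n. \<not> d \<le> lookup m i"
      using m mexp unfolding large_exponents_def by blast
    then have small: "lookup m i < d" if "i \<le> n" for i
      using that not_le by blast
    \<comment> \<open>The complement of \<open>m\<close> in the socle monomial, whose exponents all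
      equal \<open>d - 1\<close>.\<close>
    define m' where "m' = exponent_of n (\<lambda>i. d - 1 - lookup m i)"
    have "monom_deg m' = (\<Sum>i\<le>n. d - 1) - (\<Sum>i\<le>n. lookup m i)"
      unfolding m'_def monom_deg_exponent_of using small
      by (intro sum_subtractf_nat) (metis Suc_pred' atMost_iff d less_Suc_eq_le less_eq_Suc_le One_nat_def)
    also have "\<dots> = t - e"
      using deg mexp by (simp add: t_def monom_deg_eq[of m n])
    finally have "single m' 1 \<in> homogeneous n (int (t - e))"
      by (simp add: homogeneous_eq m'_def)
    from surj[OF e this] obtain g where g: "g \<in> homogeneous n (int e)"
        "single m' 1 - l ^ (t - 2 * e) * g \<in> ?I"
      by auto
    \<comment> \<open>Modulo the ideal, \<open>f * single m' 1\<close> equals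
      \<open>(l ^ (t - 2 * e) * f) * g\<close>, hence vanishes; but its coefficient at the socle
      monomial is the coefficient of \<open>f\<close> at \<open>m\<close>.\<close>
    have "f * (single m' 1 - l ^ (t - 2 * e) * g) + (l ^ (t - 2 * e) * f) * g \<in> ?I"
      using g lf f homogeneous_carrier by (blast intro: monomial_ci_closed)
    also have "f * (single m' 1 - l ^ (t - 2 * e) * g) + (l ^ (t - 2 * e) * f) * g = f * single m' 1"
      by (simp add: algebra_simps)
    finally have "f * single m' 1 \<in> ?I" .
    moreover have "lookup (f * single m' 1) (m + m') \<noteq> 0"
      using m by (simp add: lookup_mult_single in_keys_iff)
    ultimately have "m + m' \<in> large_exponents n d"
      by (auto simp: monomial_ci_eq in_keys_iff)
    then obtain i where "i \<le> n" "d \<le> lookup m i + (d - 1 - lookup m i)"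
      by (auto simp: large_exponents_def lookup_add m'_def lookup_exponent_of split: if_splits)
    with small[of i] show False
      by simp
  qed
  show ?thesis
    unfolding lefschetz_element_def
  proof (intro allI impI)
    fix e :: int and k :: nat
    assume "k \<ge> 1"
    \<comment> \<open>The source is zero in the first case and the target is zero modulo the ideal
      in the last. In between, the comparison of \<open>e + k\<close> with \<open>t - e\<close>
      decides: \<open>l ^ k\<close> is either the first factor of an injective power or the last
      factor of a surjective one.\<close>
    consider "e < 0" | "0 \<le> e" "e + int k \<le> int t - e" | "0 \<le> e" "e + int k > int t - e" "e + int k \<le> int t"
      | "e + int k > int t"
      by linarith
    then show "(\<forall>f\<in>homogeneous n e. l ^ k * f \<in> ?I \<longrightarrow> f \<in> ?I) \<or>
        (\<forall>h\<in>homogeneous n (e + int k). \<exists>f\<in>homogeneous n e. h - l ^ k * f \<in> ?I)"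
    proof cases
      case 1
      then have "f \<in> ?I" if "f \<in> homogeneous n e" for f
        using homogeneous_negative[OF _ that] by simp
      then show ?thesis
        by blast
    next
      case 2
      define e' where "e' = nat e"
      have e': "e = int e'" "2 * e' + k \<le> t"
        using 2 by (auto simp: e'_def)
      have "f \<in> ?I" if f: "f \<in> homogeneous n e" "l ^ k * f \<in> ?I" for f
      proof (rule inj)
        have "l ^ (t - 2 * e' - k) * (l ^ k * f) \<in> ?I"
          using f(2) lpow homogeneous_carrier by (blast intro: monomial_ci_closed)
        moreover have "t - 2 * e' = (t - 2 * e' - k) + k"
          using e' by simp
        ultimately show "l ^ (t - 2 * e') * f \<in> ?I"
          by (metis mult.assoc power_add)
      qed (use f e' in auto)
      then show ?thesis
        by blast
    next
      case 3
      \<comment> \<open>The degree dual to the target \<open>e + k\<close>. The surjection from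
        degree \<open>s\<close> onto degree \<open>t - s = e + k\<close> is multiplication by
        \<open>l ^ j\<close> followed by \<open>l ^ k\<close>.\<close>
      define s where "s = nat (int t - e - int k)"
      define j where "j = nat (e - int s)"
      have s: "e + int k = int (t - s)" "2 * s \<le> t" "t - 2 * s = k + j" "int s + int j = e"
        using 3 by (auto simp: s_def j_def)
      have "\<exists>f\<in>homogeneous n e. h - l ^ k * f \<in> ?I" if "h \<in> homogeneous n (e + int k)" for h
      proof -
        from that surj[OF s(2), of h] s obtain g where
          "g \<in> homogeneous n (int s)" "h - l ^ (k + j) * g \<in> ?I"
          by auto
        then show ?thesis
          using lpow_times[of g "int s" j] s(4)
          by (intro bexI[of _ "l ^ j * g"]) (auto simp: power_add mult.assoc)
      qed
      then show ?thesis
        by blast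
    next
      case 4
      have "h \<in> ?I" if "h \<in> homogeneous n (e + int k)" for h
        using homogeneous_high_degree[OF that] 4 by (simp add: t_def)
      then have "\<forall>h\<in>homogeneous n (e + int k). \<exists>f\<in>homogeneous n e. h - l ^ k * f \<in> ?I"
        by (intro ballI bexI[of _ 0]) auto
      then show ?thesis
        by blast
    qed
  qed
qed

section \<open>Failure in positive characteristic\<close>

text \<open>Integers are embedded as constant polynomials. This makes the Frobenius identity
  available for polynomials.\<close>

lemma CHAR_poly_mapping: "CHAR('k::field mpoly) = CHAR('k)"
proof (rule CHAR_eqI)
  have of_nat_mpoly: "(of_nat x :: 'k mpoly) = single 0 (of_nat x)" for x
    by simp
  show "of_nat CHAR('k) = (0 :: 'k mpoly)"
    by (simp only: of_nat_mpoly of_nat_CHAR) simp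
  show "CHAR('k) dvd x" if "of_nat x = (0 :: 'k mpoly)" for x
    using that by (metis lookup_single_eq lookup_zero of_nat_eq_0_iff_char_dvd of_nat_mpoly)
qed

text \<open>Greedy filling: the last part takes as much as \<open>B\<close> allows. It provides a
  monomial of prescribed degree with all exponents at most \<open>B\<close>.\<close>

lemma bounded_composition:
  "S \<le> (n + 1) * B \<Longrightarrow> \<exists>g. (\<forall>i\<le>n. g i \<le> B) \<and> (\<Sum>i\<le>n. g i) = (S::nat)"
proof (induction n arbitrary: S)
  case 0
  then show ?case
    by (intro exI[of _ "\<lambda>_. S"]) auto
next
  case (Suc n)
  from Suc.IH[of "S - min S B"] Suc.prems obtain g where
    "\<forall>i\<le>n. g i \<le> B" "(\<Sum>i\<le>n. g i) = S - min S B"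
    by fastforce
  then show ?case
    by (intro exI[of _ "g(Suc n := min S B)"]) (auto simp: le_Suc_eq)
qed

text \<open>The exponents of the monomials of degree \<open>k\<close> in the variables
  \<open>x_i^q\<close>; \<open>b\<close> is the exponent vector with respect to these.\<close>

definition scaled_exponents :: "nat \<Rightarrow> nat \<Rightarrow> nat \<Rightarrow> (nat \<Rightarrow>\<^sub>0 nat) set" where
  "scaled_exponents n q k =
    {m \<in> exponents n. \<exists>b\<in>exponents n. monom_deg b = k \<and> (\<forall>i. lookup m i = q * lookup b i)}"

lemma scaled_exponents_pigeonhole:
  assumes "m \<in> scaled_exponents n q k" "c \<ge> 1" "k > (n + 1) * (c - 1)"
  shows "\<exists>i\<le>n. q * c \<le> lookup m i"
proof -
  obtain b where b: "b \<in> exponents n" "monom_deg b = k" "\<And>i. lookup m i = q * lookup b i"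
    using assms by (auto simp: scaled_exponents_def)
  have "\<exists>i\<le>n. c \<le> lookup b i"
  proof (rule ccontr)
    assume "\<not> (\<exists>i\<le>n. c \<le> lookup b i)"
    then have "(\<Sum>i\<le>n. lookup b i) \<le> (\<Sum>i\<le>n. c - 1)"
      by (intro sum_mono) force
    with b assms show False
      by (simp add: monom_deg_eq)
  qed
  then show ?thesis
    using b by auto
qed

text \<open>By the Frobenius identity \<open>l ^ q\<close> is the sum of the \<open>q\<close>-th
  powers of its terms, so it is a linear form in the \<open>x_i^q\<close>; its \<open>k\<close>-th
  power is then a form of degree \<open>k\<close> in them.\<close>

lemma keys_frobenius_power:
  fixes l :: "'k::field mpoly"
  assumes p: "prime CHAR('k)" and q: "q = CHAR('k) ^ r" and l: "l \<in> homogeneous n 1"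
  shows "keys (l ^ (q * k)) \<subseteq> scaled_exponents n q k"
proof -
  have single_power: "\<exists>b. single m c ^ j = single b (c ^ j) \<and> (\<forall>i. lookup b i = j * lookup m i)"
    for m :: "nat \<Rightarrow>\<^sub>0 nat" and c :: 'k and j
  proof (induction j)
    case 0
    then show ?case
      by (intro exI[of _ 0]) auto
  next
    case (Suc j)
    then obtain b where "single m c ^ j = single b (c ^ j)" "\<forall>i. lookup b i = j * lookup m i"
      by blast
    then show ?case
      by (intro exI[of _ "m + b"]) (auto simp: mult_single lookup_add)
  qed
  have "l ^ q = (\<Sum>m\<in>keys l. single m (lookup l m)) ^ q"
    using poly_mapping_sum_single[of l] by simp
  also have "\<dots> = (\<Sum>m\<in>keys l. single m (lookup l m) ^ q)"
    using p q by (intro freshmans_dream_sum') (auto simp: CHAR_poly_mapping)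
  finally have "keys (l ^ q) \<subseteq> (\<Union>m\<in>keys l. keys (single m (lookup l m) ^ q))"
    using keys_sum by metis
  also have "\<dots> \<subseteq> scaled_exponents n q 1"
  proof safe
    fix m x assume m: "m \<in> keys l" "x \<in> keys (single m (lookup l m) ^ q)"
    obtain b where b: "single m (lookup l m) ^ q = single b (lookup l m ^ q)"
      "\<forall>i. lookup b i = q * lookup m i"
      using single_power by blast
    have x: "x = b"
      using m(2) b(1) by (auto split: if_splits)
    have "m \<in> exponents n" "monom_deg m = 1"
      using m(1) l by (auto simp: homogeneous_eq)
    moreover from this have "b \<in> exponents n"
      using b(2) by (auto simp: exponents_def in_keys_iff)
    ultimately show "x \<in> scaled_exponents n q 1"
      using x b(2) by (auto simp: scaled_exponents_def)
  qed
  finally have base: "keys (l ^ q) \<subseteq> scaled_exponents n q 1" .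
  show ?thesis
  proof (induction k)
    case 0
    show ?case
      by (auto simp: scaled_exponents_def intro!: bexI[of _ 0])
  next
    case (Suc k)
    show ?case
    proof
      fix m assume "m \<in> keys (l ^ (q * Suc k))"
      then obtain a b where ab: "m = a + b" "a \<in> keys (l ^ q)" "b \<in> keys (l ^ (q * k))"
        by (auto simp: power_add dest!: keys_timesD)
      from ab base have "a \<in> scaled_exponents n q 1"
        by blast
      then obtain a' where a': "a \<in> exponents n" "a' \<in> exponents n" "monom_deg a' = 1"
          "\<forall>i. lookup a i = q * lookup a' i"
        unfolding scaled_exponents_def by blast
      from ab Suc have "b \<in> scaled_exponents n q k"
        by blast
      then obtain b' where b': "b \<in> exponents n" "b' \<in> exponents n" "monom_deg b' = k"
          "\<forall>i. lookup b i = q * lookup b' i"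
        unfolding scaled_exponents_def by blast
      show "m \<in> scaled_exponents n q (Suc k)"
        unfolding scaled_exponents_def using ab a' b'
        by (auto intro!: bexI[of _ "a' + b'"]
            simp: exponents_add monom_deg_add lookup_add algebra_simps)
    qed
  qed
qed

text \<open>With \<open>k = (n + 1) (c - 1) + 1\<close>, the power \<open>l ^ (q k)\<close> kills \<open>(x\<^sub>0 \<cdots> x\<^sub>n)\<^sup>\<rho>\<close>, while a
  monomial of the target degree all of whose exponents are at most \<open>B < q c\<close> is not in its image.\<close>

lemma not_lefschetz_element:
  fixes l :: "'k::field mpoly"
  assumes p: "prime CHAR('k)" and q: "q = CHAR('k) ^ r" and l: "l \<in> homogeneous n 1"
    and c: "c \<ge> 1" and d: "d \<le> q * c + \<rho>" "\<rho> < d" and B: "B < d" "B < q * c"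
    and le: "q * ((n + 1) * (c - 1) + 1) + (n + 1) * \<rho> \<le> (n + 1) * B"
  shows "\<not> lefschetz_element n d l"
proof
  assume lef: "lefschetz_element n d l"
  define k where "k = (n + 1) * (c - 1) + 1"
  define e where "e = (n + 1) * \<rho>"
  have "q > 0"
    using q p prime_gt_0_nat by simp
  then have "q * k \<ge> 1"
    by (simp add: k_def)
  let ?I = "monomial_ci n d :: 'k mpoly set"
  note keys_l = keys_frobenius_power[OF p q l, of k]
  consider (inj) "\<forall>f\<in>homogeneous n (int e). l ^ (q * k) * f \<in> ?I \<longrightarrow> f \<in> ?I"
    | (surj) "\<forall>h\<in>homogeneous n (int e + int (q * k)).
        \<exists>f\<in>homogeneous n (int e). h - l ^ (q * k) * f \<in> ?I"
    using lef \<open>q * k \<ge> 1\<close> unfolding lefschetz_element_def by blast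
  then show False
  proof cases
    case inj
    define x where "x = exponent_of n (\<lambda>_. \<rho>)"
    have "single x (1::'k) \<in> homogeneous n (int e)"
      by (simp add: homogeneous_eq x_def e_def monom_deg_exponent_of)
    \<comment> \<open>The pigeonhole principle gives every term of \<open>l ^ (q * k)\<close> an
      exponent at least \<open>q * c\<close>; adding \<open>\<rho>\<close> brings it to at least
      \<open>d\<close>.\<close>
    moreover have "l ^ (q * k) * single x 1 \<in> ?I"
      unfolding monomial_ci_eq
    proof safe
      fix m assume "m \<in> keys (l ^ (q * k) * single x 1)"
      then obtain a where a: "a \<in> scaled_exponents n q k" "m = a + x"
        using keys_l by (auto dest!: keys_timesD)
      obtain i where i: "i \<le> n" "q * c \<le> lookup a i"
        using scaled_exponents_pigeonhole[OF a(1) c] by (auto simp: k_def)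
      have "a \<in> exponents n"
        using a by (simp add: scaled_exponents_def)
      then show "m \<in> large_exponents n d"
        using a i d unfolding large_exponents_def
        by (auto intro!: exponents_add exI[of _ i] simp: x_def lookup_add lookup_exponent_of)
    qed
    ultimately have "single x (1::'k) \<in> ?I"
      using inj by blast
    with d show False
      by (auto simp: monomial_ci_eq large_exponents_def x_def lookup_exponent_of)
  next
    case surj
    obtain g where g: "\<forall>i\<le>n. g i \<le> B" "(\<Sum>i\<le>n. g i) = e + q * k"
      using bounded_composition[of "e + q * k" n B] le by (auto simp: e_def k_def add.commute)
    define x where "x = exponent_of n g"
    have "single x (1::'k) \<in> homogeneous n (int e + int (q * k))"
      by (simp add: homogeneous_eq x_def monom_deg_exponent_of g)
    with surj obtain f where f: "f \<in> homogeneous n (int e)" "single x 1 - l ^ (q * k) * f \<in> ?I"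
      by blast
    \<comment> \<open>The monomial \<open>x\<close> survives modulo the ideal, so it must occur in
      \<open>l ^ (q * k) * f\<close>; but each term of that product has some exponent at least
      \<open>q * c\<close>, which exceeds \<open>B\<close>.\<close>
    have "x \<notin> large_exponents n d"
      using g B by (auto simp: large_exponents_def x_def lookup_exponent_of)
    then have "lookup (single x 1 - l ^ (q * k) * f) x = 0"
      using f by (auto simp: monomial_ci_eq in_keys_iff)
    then have "x \<in> keys (l ^ (q * k) * f)"
      by (simp add: lookup_minus in_keys_iff)
    then obtain a b where a: "a \<in> scaled_exponents n q k" "x = a + b"
      using keys_l by (auto dest!: keys_timesD)
    obtain i where i: "i \<le> n" "q * c \<le> lookup a i"
      using scaled_exponents_pigeonhole[OF a(1) c] by (auto simp: k_def)
    have "lookup a i \<le> lookup x i"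
      by (simp add: a lookup_add)
    also have "\<dots> \<le> B"
      using g i by (simp add: x_def lookup_exponent_of)
    finally show False
      using i B by simp
  qed
qed

section \<open>Large characteristic: the lowering operator\<close>

definition const :: "'k \<Rightarrow> 'k::field mpoly" where
  "const c = single 0 c"

lemma lookup_const_mult: "lookup (const c * f) m = c * lookup f m"
  using lookup_mult_single[of f 0 c m] by (simp add: const_def mult.commute)

lemma const_mult: "const a * const b = const (a * b)"
  by (simp add: const_def mult_single)

lemma const_add: "const a + const b = const (a + b)"
  by (simp add: const_def single_add)

lemma const_one: "const 1 = 1"
  by (simp add: const_def)

lemma keys_const_mult: "keys (const c * f) \<subseteq> keys f"
  by (auto simp: in_keys_iff lookup_const_mult)

lemma const_homogeneous: "const c \<in> homogeneous n 0"
  by (simp add: homogeneous_eq const_def)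

lemma const_carrier: "const c \<in> carrier (poly_ring n)"
  using const_homogeneous homogeneous_carrier by blast

text \<open>The coefficient in \<open>F x^a = a (d - a) x^(a-1)\<close> for the irreducible
  \<open>sl_2\<close>-module of dimension \<open>d\<close>. It is computed over the integers because
  exponents may exceed \<open>d\<close>. Its zero at \<open>0\<close> hides the truncated
  subtraction of exponents, its zero at \<open>d\<close> makes the ideal stable.\<close>

definition weight :: "nat \<Rightarrow> nat \<Rightarrow> 'k::field" where
  "weight d x = of_int (int x * (int d - int x))"

text \<open>In characteristic 0 and modulo \<open>x\<^sub>i\<^sup>d\<close> this is the lowering operator of the
  \<open>sl\<^sub>2\<close>-module \<open>V\<^sub>d\<^sub>-\<^sub>1 \<otimes> \<cdots> \<otimes> V\<^sub>d\<^sub>-\<^sub>1\<close> on which multiplication by \<open>x\<^sub>0 + \<cdots> + x\<^sub>n\<close>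
  is the raising operator.\<close>

definition lowering :: "nat \<Rightarrow> nat \<Rightarrow> 'k::field mpoly \<Rightarrow> 'k mpoly" where
  "lowering n d f =
     (\<Sum>m\<in>keys f. \<Sum>i\<le>n. single (m - single i 1) (weight d (lookup m i) * lookup f m))"

text \<open>Extra summands have coefficient zero. A common index set for several polynomials makes
  linearity visible.\<close>

lemma lowering_superset:
  assumes "finite S" "keys f \<subseteq> S"
  shows "lowering n d f =
     (\<Sum>m\<in>S. \<Sum>i\<le>n. single (m - single i 1) (weight d (lookup m i) * lookup f m))"
  unfolding lowering_def using assms by (intro sum.mono_neutral_left) (auto simp: in_keys_iff)

lemma lowering_single:
  "lowering n d (single m c) = (\<Sum>i\<le>n. single (m - single i 1) (weight d (lookup m i) * c))"
  using lowering_superset[of "{m}" "single m c" n d] by simp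

lemma lowering_add: "lowering n d (f + g) = lowering n d f + lowering n d g"
proof -
  let ?S = "keys f \<union> keys g"
  have "keys (f + g) \<subseteq> ?S"
    by (rule keys_add)
  then show ?thesis
    by (simp add: lowering_superset[of ?S] lookup_add algebra_simps single_add sum.distrib)
qed

lemma lowering_diff: "lowering n d (f - g) = lowering n d f - lowering n d g"
  using lowering_add[of n d "f - g" g] by simp

lemma lowering_zero [simp]: "lowering n d 0 = 0"
  by (simp add: lowering_def)

lemma lowering_sum: "lowering n d (sum f S) = (\<Sum>x\<in>S. lowering n d (f x))"
  by (induction S rule: infinite_finite_induct) (auto simp: lowering_add)

lemma lowering_const_mult: "lowering n d (const c * f) = const c * lowering n d f"
proof -
  have "lowering n d (const c * f) = (\<Sum>m\<in>keys f. \<Sum>i\<le>n.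
      single (m - single i 1) (weight d (lookup m i) * (c * lookup f m)))"
    using lowering_superset[OF _ keys_const_mult] by (simp add: lookup_const_mult)
  also have "\<dots> = const c * lowering n d f"
    by (simp add: lowering_def const_def sum_distrib_left mult_single algebra_simps)
  finally show ?thesis .
qed

lemma keys_lowering:
  assumes "x \<in> keys (lowering n d f)"
  obtains m i where "m \<in> keys f" "i \<le> n" "x = m - single i 1" "0 < lookup m i" "lookup m i \<noteq> d"
proof -
  obtain m where m: "m \<in> keys f"
    "x \<in> keys (\<Sum>i\<le>n. single (m - single i 1) (weight d (lookup m i) * lookup f m))"
    using assms keys_sum unfolding lowering_def by fast
  from m(2) obtain i where i: "i \<le> n"
    "x \<in> keys (single (m - single i 1) (weight d (lookup m i) * lookup f m))"
    using keys_sum by fast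
  then have "x = m - single i 1" "weight d (lookup m i) \<noteq> (0 :: 'a)"
    by (auto split: if_splits)
  moreover from this have "0 < lookup m i" "lookup m i \<noteq> d"
    by (auto simp: weight_def intro!: Nat.gr0I)
  ultimately show thesis
    using m i that by blast
qed

lemma exponents_minus_single: "m \<in> exponents n \<Longrightarrow> m - single i 1 \<in> exponents n"
  by (auto simp: exponents_def in_keys_iff lookup_minus)

lemma lowering_homogeneous:
  assumes "f \<in> homogeneous n e"
  shows "lowering n d f \<in> homogeneous n (e - 1)"
  unfolding homogeneous_eq
proof safe
  fix x assume "x \<in> keys (lowering n d f)"
  then obtain m i where m: "m \<in> keys f" "i \<le> n" "x = m - single i 1" "0 < lookup m i"
    by (rule keys_lowering)
  from m assms have e: "m \<in> exponents n" "int (monom_deg m) = e"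
    by (auto simp: homogeneous_eq)
  then show x: "x \<in> exponents n"
    using m exponents_minus_single by blast
  have "m = x + single i 1"
    by (rule poly_mapping_eqI) (use m in \<open>auto simp: lookup_add lookup_minus lookup_single when_def\<close>)
  then have "monom_deg m = monom_deg x + 1"
    using monom_deg_add[OF x exponents_single[OF m(2), of 1]] by simp
  with e show "int (monom_deg x) = e - 1"
    by simp
qed

text \<open>An exponent equal to \<open>d\<close> is never lowered, since its weight is zero, and an
  exponent above \<open>d\<close> stays at least \<open>d\<close>. So the operator descends to the
  quotient.\<close>

lemma lowering_monomial_ci:
  assumes "f \<in> monomial_ci n d"
  shows "lowering n d f \<in> monomial_ci n d"
  unfolding monomial_ci_eq
proof safe
  fix x assume "x \<in> keys (lowering n d f)"
  then obtain m i where m: "m \<in> keys f" "x = m - single i 1" "lookup m i \<noteq> d"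
    by (rule keys_lowering)
  from m assms obtain j where j: "m \<in> exponents n" "j \<le> n" "d \<le> lookup m j"
    by (auto simp: monomial_ci_eq large_exponents_def)
  have "d \<le> lookup x j"
    using m j by (auto simp: lookup_minus lookup_single when_def)
  then show "x \<in> large_exponents n d"
    using j m exponents_minus_single unfolding large_exponents_def by blast
qed

definition var_sum :: "nat \<Rightarrow> 'k::field mpoly" where
  "var_sum n = (\<Sum>i\<le>n. Var i)"

lemma var_sum_homogeneous: "var_sum n \<in> homogeneous n 1"
  unfolding var_sum_def
  by (rule homogeneous_sum) (simp add: homogeneous_eq Var_def exponents_single)

text \<open>Raising in one variable commutes with lowering in another. In the same variable with
  exponent \<open>a\<close> the difference of weights is
  \<open>(a + 1) (d - a - 1) - a (d - a) = d - 1 - 2 a\<close>, and these contributions add up to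
  the scalar.\<close>

lemma lowering_commutator_single:
  fixes c :: "'k::field"
  assumes m: "m \<in> exponents n"
  shows "lowering n d (var_sum n * single m c) = var_sum n * lowering n d (single m c) +
    const (of_int (int (n + 1) * (int d - 1) - 2 * int (monom_deg m))) * single m c"
proof -
  let ?w = "\<lambda>x. weight d x :: 'k"
  have *: "single (m + single j 1 - single i 1) (?w (lookup (m + single j 1) i) * c) =
      single (m - single i 1 + single j 1) (?w (lookup m i) * c) +
      (if i = j then single m (of_int (int d - 1 - 2 * int (lookup m i)) * c) else 0)" for i j
  proof (cases "i = j")
    case True
    have shift: "m + single j 1 - single i 1 = m"
      by (rule poly_mapping_eqI) (use True in \<open>auto simp: lookup_add lookup_minus\<close>)
    \<comment> \<open>If the exponent is \<open>0\<close>, lowering and raising does not give back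
      \<open>m\<close>, but the weight is then zero.\<close>
    have restore: "single (m - single i 1 + single j 1) (?w (lookup m i) * c) =
        single m (?w (lookup m i) * c)"
    proof (cases "lookup m i = 0")
      case False
      then have "m - single i 1 + single j 1 = m"
        using True
        by (intro poly_mapping_eqI) (auto simp: lookup_add lookup_minus lookup_single when_def)
      then show ?thesis
        by simp
    qed (simp add: weight_def)
    have "?w (lookup (m + single j 1) i) =
        ?w (lookup m i) + of_int (int d - 1 - 2 * int (lookup m i))"
      unfolding weight_def of_int_add[symmetric] using True
      by (simp only: lookup_add lookup_single_eq) (simp add: algebra_simps)
    then show ?thesis
      unfolding shift restore using True by (simp only: distrib_right single_add refl if_True)
  next
    case False
    then have eq: "lookup (m + single j 1) i = lookup m i"
      by (simp add: lookup_add lookup_single)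
    show ?thesis
    proof (cases "lookup m i = 0")
      case True
      with False eq show ?thesis
        by (simp add: weight_def)
    next
      case nz: False
      with False have "m + single j 1 - single i 1 = m - single i 1 + single j 1"
        by (intro poly_mapping_eqI) (auto simp: lookup_add lookup_minus lookup_single when_def)
      with False eq show ?thesis
        by simp
    qed
  qed
  have "lowering n d (var_sum n * single m c) =
      (\<Sum>j\<le>n. lowering n d (single (m + single j 1) c))"
    by (simp add: var_sum_def Var_def sum_distrib_right mult_single lowering_sum add.commute)
  also have "\<dots> = (\<Sum>j\<le>n. \<Sum>i\<le>n. single (m - single i 1 + single j 1) (?w (lookup m i) * c)) +
      (\<Sum>i\<le>n. single m (of_int (int d - 1 - 2 * int (lookup m i)) * c))"
    unfolding lowering_single * sum.distrib by simp
  also have "(\<Sum>j\<le>n. \<Sum>i\<le>n. single (m - single i 1 + single j 1) (?w (lookup m i) * c)) =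
      var_sum n * lowering n d (single m c)"
    by (simp add: var_sum_def Var_def lowering_single sum_distrib_left sum_distrib_right
        mult_single add.commute)
      (rule sum.swap)
  also have "(\<Sum>i\<le>n. single m (of_int (int d - 1 - 2 * int (lookup m i)) * c)) =
      single m (of_int (\<Sum>i\<le>n. int d - 1 - 2 * int (lookup m i)) * c)"
    by (rule poly_mapping_eqI) (simp add: lookup_sum lookup_single when_def sum_distrib_right)
  also have "(\<Sum>i\<le>n. int d - 1 - 2 * int (lookup m i)) =
      int (n + 1) * (int d - 1) - 2 * int (monom_deg m)"
    using m by (simp add: sum_subtractf monom_deg_eq sum_distrib_left)
  finally show ?thesis
    by (simp add: const_def mult_single)
qed

lemma lowering_commutator:
  fixes f :: "'k::field mpoly"
  assumes f: "f \<in> homogeneous n e"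
  shows "lowering n d (var_sum n * f) = var_sum n * lowering n d f +
    const (of_int (int (n + 1) * (int d - 1) - 2 * e)) * f"
proof -
  let ?c = "const (of_int (int (n + 1) * (int d - 1) - 2 * e)) :: 'k mpoly"
  have "lowering n d (var_sum n * (\<Sum>m\<in>keys f. single m (lookup f m))) =
      (\<Sum>m\<in>keys f. lowering n d (var_sum n * single m (lookup f m)))"
    by (simp add: sum_distrib_left lowering_sum)
  also have "\<dots> = (\<Sum>m\<in>keys f. var_sum n * lowering n d (single m (lookup f m)) +
      ?c * single m (lookup f m))"
  proof (rule sum.cong)
    fix m assume "m \<in> keys f"
    then have "m \<in> exponents n" "int (monom_deg m) = e"
      using f by (auto simp: homogeneous_eq)
    then show "lowering n d (var_sum n * single m (lookup f m)) =
        var_sum n * lowering n d (single m (lookup f m)) + ?c * single m (lookup f m)"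
      by (simp only: lowering_commutator_single)
  qed simp
  also have "\<dots> = var_sum n * lowering n d (\<Sum>m\<in>keys f. single m (lookup f m)) +
      ?c * (\<Sum>m\<in>keys f. single m (lookup f m))"
    by (simp add: sum.distrib sum_distrib_left lowering_sum)
  finally show ?thesis
    by (simp flip: poly_mapping_sum_single)
qed

lemma lowering_power_homogeneous:
  "f \<in> homogeneous n e \<Longrightarrow> (lowering n d ^^ k) f \<in> homogeneous n (e - int k)"
proof (induction k)
  case (Suc k)
  then show ?case
    using lowering_homogeneous[of "(lowering n d ^^ k) f" n "e - int k" d]
    by (simp add: algebra_simps)
qed simp

text \<open>With \<open>E\<close> the multiplication by \<open>var_sum n\<close> and
  \<open>L\<close> the lowering operator, a form \<open>h\<close> killed by \<open>E\<close> behaves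
  like a highest weight vector of weight \<open>N\<close>. Hence \<open>E ^ N\<close> takes
  \<open>L ^ N\<close> of \<open>h\<close> to \<open>(N!)^2\<close> times \<open>h\<close>, and this
  scalar is invertible when no integer from \<open>1\<close> to \<open>t\<close> vanishes in the
  field.\<close>

lemma lefschetz_large_char:
  fixes n d :: nat
  defines "t \<equiv> (n + 1) * (d - 1)"
  assumes d: "d \<ge> 1" and char: "\<And>j. 1 \<le> j \<Longrightarrow> j \<le> t \<Longrightarrow> of_nat j \<noteq> (0 :: 'k::field)"
  shows "lefschetz_element n d (var_sum n :: 'k mpoly)"
proof (rule lefschetz_criterion[OF d var_sum_homogeneous])
  fix e and h :: "'k mpoly"
  assume "2 * e \<le> (n + 1) * (d - 1)" "h \<in> homogeneous n (int ((n + 1) * (d - 1) - e))"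
    and lh: "var_sum n * h \<in> monomial_ci n d"
  then have e: "2 * e \<le> t" and h: "h \<in> homogeneous n (int (t - e))"
    by (simp_all add: t_def)
  let ?I = "monomial_ci n d :: 'k mpoly set"
  define L where "L = (lowering n d :: 'k mpoly \<Rightarrow> 'k mpoly)"
  define N where "N = t - 2 * e"
  let ?E = "var_sum n :: 'k mpoly"
  have t: "int (n + 1) * (int d - 1) = int t"
    unfolding t_def of_nat_mult using d by (simp add: of_nat_diff)
  have comm: "?E * L ((L ^^ k) h) = L (?E * (L ^^ k) h) + const (of_int (int N - 2 * int k)) * (L ^^ k) h"
    for k
  proof -
    have "(L ^^ k) h \<in> homogeneous n (int (t - e) - int k)"
      unfolding L_def by (rule lowering_power_homogeneous[OF h])
    from lowering_commutator[OF this, of d]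
    have "L (?E * (L ^^ k) h) = ?E * L ((L ^^ k) h) +
        const (of_int (int t - 2 * (int (t - e) - int k))) * (L ^^ k) h"
      unfolding L_def t .
    also have "int t - 2 * (int (t - e) - int k) = - (int N - 2 * int k)"
      using e by (simp add: N_def)
    also have "const (of_int (- (int N - 2 * int k))) = - (const (of_int (int N - 2 * int k)) :: 'k mpoly)"
      by (simp only: of_int_minus const_def single_uminus)
    finally show ?thesis
      by (simp only: minus_mult_left[symmetric] add_uminus_conv_diff diff_add_cancel)
  qed
  \<comment> \<open>The constants accumulate by
    \<open>(k + 1) (N - k) + N - 2 (k + 1) = (k + 2) (N - k - 1)\<close>. Applying \<open>L\<close>
    to the previous congruence is allowed because \<open>L\<close> preserves the ideal.\<close>
  have step: "?E * (L ^^ Suc k) h - const (of_int ((int k + 1) * (int N - int k))) * (L ^^ k) h \<in> ?I" for k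
  proof (induction k)
    case 0
    have "?E * L h - const (of_int (int N)) * h = L (?E * h)"
      using comm[of 0] by simp
    moreover have "L (?E * h) \<in> ?I"
      unfolding L_def by (rule lowering_monomial_ci[OF lh])
    ultimately show ?case
      by simp
  next
    case (Suc k)
    let ?c = "const (of_int ((int k + 1) * (int N - int k))) :: 'k mpoly"
    have "L (?E * (L ^^ Suc k) h - ?c * (L ^^ k) h) \<in> ?I"
      unfolding L_def by (rule lowering_monomial_ci[OF Suc[unfolded L_def]])
    also have "L (?E * (L ^^ Suc k) h - ?c * (L ^^ k) h) =
        L (?E * (L ^^ Suc k) h) - ?c * (L ^^ Suc k) h"
      by (simp add: L_def lowering_diff lowering_const_mult)
    also have "\<dots> = ?E * (L ^^ Suc (Suc k)) h -
        (?c + const (of_int (int N - 2 * int (Suc k)))) * (L ^^ Suc k) h"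
      using comm[of "Suc k"] by (simp add: algebra_simps)
    also have "?c + const (of_int (int N - 2 * int (Suc k))) =
        const (of_int ((int (Suc k) + 1) * (int N - int (Suc k))))"
      unfolding const_add of_int_add[symmetric] by (simp add: algebra_simps)
    finally show ?case .
  qed
  have pow: "?E ^ k * (L ^^ k) h - const (of_nat (\<Prod>j<k. (j + 1) * (N - j))) * h \<in> ?I"
    if "k \<le> N" for k
    using that
  proof (induction k)
    case 0
    then show ?case
      by (simp add: const_one)
  next
    case (Suc k)
    let ?a = "const (of_int ((int k + 1) * (int N - int k))) :: 'k mpoly"
    let ?b = "const (of_nat (\<Prod>j<k. (j + 1) * (N - j))) :: 'k mpoly"
    have "(int k + 1) * (int N - int k) = int ((k + 1) * (N - k))"
      using Suc.prems by (simp only: of_nat_mult of_nat_add of_nat_1 of_nat_diff[OF Suc_leD])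
    then have ab: "?a * ?b = const (of_nat (\<Prod>j<Suc k. (j + 1) * (N - j)))"
      unfolding const_mult
      by (simp only: of_int_mult of_int_of_nat_eq prod.lessThan_Suc of_nat_mult mult_ac)
    have carr: "?E ^ k \<in> carrier (poly_ring n)"
      using homogeneous_power[OF var_sum_homogeneous] homogeneous_carrier by blast
    have "?E ^ k * (?E * (L ^^ Suc k) h - ?a * (L ^^ k) h) \<in> ?I"
      by (rule monomial_ci_closed(4)[OF step carr])
    moreover have "?a * (?E ^ k * (L ^^ k) h - ?b * h) \<in> ?I"
      by (rule monomial_ci_closed(4)[OF _ const_carrier]) (use Suc in simp)
    ultimately have "?E ^ k * (?E * (L ^^ Suc k) h - ?a * (L ^^ k) h) +
        ?a * (?E ^ k * (L ^^ k) h - ?b * h) \<in> ?I"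
      by (rule monomial_ci_closed(1))
    also have "?E ^ k * (?E * (L ^^ Suc k) h - ?a * (L ^^ k) h) + ?a * (?E ^ k * (L ^^ k) h - ?b * h) =
        ?E ^ Suc k * (L ^^ Suc k) h - ?a * ?b * h"
      by (simp add: algebra_simps)
    finally show ?case
      unfolding ab .
  qed
  \<comment> \<open>This is \<open>(N!)^2\<close>; all its factors lie between \<open>1\<close> and
    \<open>N \<le> t\<close>.\<close>
  define c where "c = (of_nat (\<Prod>j<N. (j + 1) * (N - j)) :: 'k)"
  have "c \<noteq> 0"
  proof -
    have "of_nat ((j + 1) * (N - j)) \<noteq> (0 :: 'k)" if "j < N" for j
    proof -
      have "of_nat (j + 1) \<noteq> (0 :: 'k)" "of_nat (N - j) \<noteq> (0 :: 'k)"
        by (rule char; use that in \<open>simp add: N_def\<close>)+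
      then show ?thesis
        by (simp only: of_nat_mult mult_eq_0_iff) blast
    qed
    then show ?thesis
      unfolding c_def of_nat_prod by (meson finite_lessThan lessThan_iff prod_zero_iff)
  qed
  then have inv: "const (1 / c) * const c = 1"
    by (simp add: const_mult const_one)
  let ?f = "const (1 / c) * (L ^^ N) h"
  have "(L ^^ N) h \<in> homogeneous n (int (t - e) - int N)"
    unfolding L_def by (rule lowering_power_homogeneous[OF h])
  also have "int (t - e) - int N = int e"
    using e by (simp add: N_def)
  finally have "?f \<in> homogeneous n (int e)"
    using homogeneous_times[OF const_homogeneous, of "(L ^^ N) h" n "int e"] by simp
  moreover have "h - ?E ^ N * ?f \<in> ?I"
  proof -
    have "- (const (1 / c) * (?E ^ N * (L ^^ N) h - const c * h)) \<in> ?I"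
      unfolding c_def
      by (rule monomial_ci_closed(3)[OF monomial_ci_closed(4)[OF pow[OF order.refl] const_carrier]])
    also have "- (const (1 / c) * (?E ^ N * (L ^^ N) h - const c * h)) =
        (const (1 / c) * const c) * h - ?E ^ N * ?f"
      by (simp add: algebra_simps)
    finally show ?thesis
      by (simp add: inv)
  qed
  ultimately show "\<exists>f\<in>homogeneous n (int e). h - ?E ^ ((n + 1) * (d - 1) - 2 * e) * f \<in> ?I"
    unfolding N_def t_def by blast
qed

section \<open>Binomial coefficients\<close>

text \<open>The \<open>N\<close>-th finite difference of a monic polynomial of degree at most
  \<open>N\<close>, given by its linear factors so that the induction can remove one factor at a
  time.\<close>

lemma alternating_binomial_prod_list:
  fixes x :: int
  shows "length cs \<le> N \<Longrightarrow>
    (\<Sum>j\<le>N. (-1) ^ j * int (N choose j) * (\<Prod>c\<leftarrow>cs. x - int j + c)) =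
    (if length cs = N then fact N else 0)"
proof (induction cs arbitrary: N x)
  case Nil
  show ?case
    using choose_alternating_sum[of N, where 'a = int] by (cases "N = 0") auto
next
  case (Cons c cs)
  then obtain M where N: "N = Suc M"
    by (cases N) auto
  define P where "P x = (\<Prod>c\<leftarrow>cs. x + c)" for x :: int
  \<comment> \<open>The removed factor is split as \<open>(x + c) - j\<close>. The part with
    \<open>j\<close> is absorbed by \<open>j C(N, j) = N C(N - 1, j - 1)\<close>, which lowers the
    order of the difference by one.\<close>
  have "(\<Sum>j\<le>N. (-1) ^ j * int (N choose j) * (int j * P (x - int j))) =
      (\<Sum>j\<le>M. (-1) ^ Suc j * int (Suc M choose Suc j) * (int (Suc j) * P (x - int (Suc j))))"
    unfolding N by (subst sum.atMost_Suc_shift) simp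
  also have "\<dots> = (\<Sum>j\<le>M. - int N * ((-1) ^ j * int (M choose j) * P (x - 1 - int j)))"
  proof (rule sum.cong)
    fix j
    have "int (Suc j) * int (Suc M choose Suc j) = int N * int (M choose j)"
      unfolding N of_nat_mult[symmetric] Suc_times_binomial ..
    moreover have "x - int (Suc j) = x - 1 - int j"
      by simp
    moreover have "a * b = u * c \<Longrightarrow> (- 1) ^ Suc j * b * (a * y) = - u * ((- 1) ^ j * c * y)"
      for a b c u y :: int
      by (simp add: mult.commute)
    ultimately show "(-1) ^ Suc j * int (Suc M choose Suc j) * (int (Suc j) * P (x - int (Suc j))) =
        - int N * ((-1) ^ j * int (M choose j) * P (x - 1 - int j))"
      by (simp only:)
  qed simp
  also have "\<dots> = - int N * (if length cs = M then fact M else 0)"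
    using Cons.IH[of M "x - 1"] Cons.prems by (simp add: N P_def sum_distrib_left[symmetric])
  finally have *: "(\<Sum>j\<le>N. (-1) ^ j * int (N choose j) * (int j * P (x - int j))) =
      - int N * (if length cs = M then fact M else 0)" .
  have "(\<Sum>j\<le>N. (-1) ^ j * int (N choose j) * (\<Prod>c\<leftarrow>c # cs. x - int j + c)) =
      (x + c) * (\<Sum>j\<le>N. (-1) ^ j * int (N choose j) * P (x - int j)) -
      (\<Sum>j\<le>N. (-1) ^ j * int (N choose j) * (int j * P (x - int j)))"
    by (simp add: P_def sum_distrib_left sum_subtractf[symmetric] algebra_simps)
  also have "(\<Sum>j\<le>N. (-1) ^ j * int (N choose j) * P (x - int j)) = 0"
    using Cons.IH[of N x] Cons.prems by (simp add: P_def)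
  also note *
  also have "(x + c) * 0 - - int N * (if length cs = M then fact M else 0) =
      (if length (c # cs) = N then fact N else 0)"
    using N by (auto simp: algebra_simps)
  finally show ?case .
qed

text \<open>Exhibits the binomial coefficient, up to the factor \<open>m!\<close>, as a monic
  polynomial in \<open>i\<close> with roots \<open>-1, ..., -m\<close>.\<close>

lemma fact_binomial_prod:
  "fact m * int ((m + i) choose m) = (\<Prod>r\<leftarrow>[1..<Suc m]. int i + int r)"
proof (induction m)
  case (Suc m)
  have "Suc m * ((m + i + 1) choose Suc m) = (m + i + 1) * ((m + i) choose m)"
    using Suc_times_binomial_eq[of "m + i" m] by (simp add: mult.commute)
  then have "int (Suc m) * int ((Suc m + i) choose Suc m) = int (m + i + 1) * int ((m + i) choose m)"
    by (metis of_nat_mult add.commute plus_1_eq_Suc add_Suc_right)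
  then have "fact (Suc m) * int ((Suc m + i) choose Suc m) =
      (fact m * int ((m + i) choose m)) * int (m + i + 1)"
    by (simp only: fact_Suc of_nat_mult of_nat_fact mult_ac)
  then show ?case
    unfolding Suc by (simp add: algebra_simps)
qed simp

text \<open>The summand is, up to sign, a polynomial of degree \<open>2 m\<close> in \<open>m + k - j\<close> that vanishes at the
  integers in \<open>[-m, -1]\<close> and \<open>[e + 1, e + m]\<close>: the sum is an iterated difference.\<close>

lemma alternating_binomial_convolution:
  assumes "k \<le> e"
  shows "(\<Sum>i\<le>e. \<Sum>j\<le>2 * m. if i + j = m + k
      then (-1) ^ i * int ((m + i) choose m) * int ((m + (e - i)) choose m) * int (2 * m choose j)
      else 0) = (-1) ^ k * int (2 * m choose m)" (is "?lhs = ?rhs")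
proof -
  define P where
    "P z = (\<Prod>r\<leftarrow>[1..<Suc m]. z + int r) * (\<Prod>r\<leftarrow>[1..<Suc m]. z + (- int e - int r))" for z :: int
  define cs where
    "cs = map int [1..<Suc m] @ map (\<lambda>r. - int e - int r) [1..<Suc m]"
  have P_cs: "P z = (\<Prod>c\<leftarrow>cs. z + c)" for z
    by (simp add: P_def cs_def o_def)
  have len: "length cs = 2 * m"
    by (simp add: cs_def)
  have prod_list_minus: "(\<Prod>r\<leftarrow>rs. (-1) * f r) = (-1) ^ length rs * (\<Prod>r\<leftarrow>rs. f r)"
    for f :: "nat \<Rightarrow> int" and rs
    by (induction rs) auto
  have P_nat: "(fact m)\<^sup>2 * (int ((m + i) choose m) * int ((m + (e - i)) choose m)) = (-1) ^ m * P (int i)"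
    if "i \<le> e" for i
  proof -
    have "(\<Prod>r\<leftarrow>[1..<Suc m]. int i + (- int e - int r)) =
        (\<Prod>r\<leftarrow>[1..<Suc m]. (-1) * (int (e - i) + int r))"
      using that by (intro arg_cong[where f = prod_list] map_cong) auto
    also have "\<dots> = (-1) ^ m * (\<Prod>r\<leftarrow>[1..<Suc m]. int (e - i) + int r)"
      using prod_list_minus[of "\<lambda>r. int (e - i) + int r" "[1..<Suc m]"]
      by (simp del: upt_Suc)
    finally have "P (int i) = (fact m * int ((m + i) choose m)) *
        ((-1) ^ m * (fact m * int ((m + (e - i)) choose m)))"
      unfolding P_def fact_binomial_prod by (simp only:)
    moreover have "(-1) ^ m * (-1) ^ m = (1 :: int)"
      by (simp flip: power_mult_distrib)
    ultimately have "(-1) ^ m * P (int i) =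
        (fact m * int ((m + i) choose m)) * (fact m * int ((m + (e - i)) choose m))"
      by simp
    then show ?thesis
      by (simp only: power2_eq_square mult_ac)
  qed
  \<comment> \<open>For \<open>j \<le> 2 * m\<close> the argument \<open>m + k - j\<close> stays in
    \<open>[-m, e + m]\<close>. Where it leaves \<open>[0, e]\<close> the polynomial vanishes, so
    the sum over admissible \<open>i\<close> extends to the full alternating sum over
    \<open>j\<close>.\<close>
  have P_zero: "P z = 0" if "- int m \<le> z" "z < 0 \<or> z > int e" "z \<le> int e + int m" for z
  proof (cases "z < 0")
    case True
    then have "0 \<in> (\<lambda>r. z + int r) ` set [1..<Suc m]"
      using that by (intro image_eqI[of _ _ "nat (- z)"]) auto
    then show ?thesis
      by (simp add: P_def prod_list_zero_iff)
  next
    case False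
    then have "0 \<in> (\<lambda>r. z + (- int e - int r)) ` set [1..<Suc m]"
      using that by (intro image_eqI[of _ _ "nat (z - int e)"]) auto
    then show ?thesis
      by (simp add: P_def prod_list_zero_iff)
  qed
  have inner: "(fact m)\<^sup>2 * (\<Sum>i\<le>e. if i + j = m + k
      then (-1) ^ i * int ((m + i) choose m) * int ((m + (e - i)) choose m) * int (2 * m choose j)
      else 0) = (-1) ^ k * ((-1) ^ j * int (2 * m choose j) * P (int (m + k) - int j))" (is "?L = ?R")
    if j: "j \<le> 2 * m" for j
  proof (cases "j \<le> m + k \<and> m + k - j \<le> e")
    case True
    define i where "i = m + k - j"
    have i: "i \<le> e" "i + j = m + k" "int (m + k) - int j = int i"
      using True by (auto simp: i_def)
    have "(\<Sum>i'\<le>e. if i' + j = m + k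
        then (-1) ^ i' * int ((m + i') choose m) * int ((m + (e - i')) choose m) * int (2 * m choose j)
        else 0) = (\<Sum>i'\<le>e. if i' = i
        then (-1) ^ i * int ((m + i) choose m) * int ((m + (e - i)) choose m) * int (2 * m choose j)
        else 0)"
      using i by (intro sum.cong) auto
    also have "\<dots> = (-1) ^ i * int (2 * m choose j) *
        (int ((m + i) choose m) * int ((m + (e - i)) choose m))"
      using i by simp
    finally have "?L = (-1) ^ i * int (2 * m choose j) * ((-1) ^ m * P (int i))"
      by (simp add: P_nat[OF i(1), symmetric])
    also have "(-1) ^ i * int (2 * m choose j) * ((-1) ^ m * P (int i)) =
        (-1) ^ (i + m) * int (2 * m choose j) * P (int i)"
      by (simp add: power_add)
    \<comment> \<open>The exponents differ by the even number \<open>2 (m - j)\<close>.\<close>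
    also have "(-1) ^ (i + m) = ((-1) ^ (k + j) :: int)"
      using i(2) by (intro minus_one_power_iff[THEN trans] minus_one_power_iff[THEN sym, THEN trans[rotated]]) presburger
    finally show ?thesis
      unfolding i(3) by (simp add: power_add)
  next
    case False
    have "P (int (m + k) - int j) = 0"
      by (rule P_zero) (use False j assms in auto)
    moreover have "(\<Sum>i\<le>e. if i + j = m + k
      then (-1) ^ i * int ((m + i) choose m) * int ((m + (e - i)) choose m) * int (2 * m choose j)
      else 0) = 0"
      using False by (intro sum.neutral) auto
    ultimately show ?thesis
      by simp
  qed
  have "(fact m)\<^sup>2 * ?lhs = (-1) ^ k * (\<Sum>j\<le>2 * m. (-1) ^ j * int (2 * m choose j) * P (int (m + k) - int j))"
    by (subst sum.swap) (simp add: sum_distrib_left[of _ _ "{..2 * m}"] inner)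
  also have "\<dots> = (-1) ^ k * fact (2 * m)"
    using alternating_binomial_prod_list[of cs "2 * m" "int (m + k)"] len
    by (simp add: P_cs)
  also have "fact (2 * m) = (fact m)\<^sup>2 * int (2 * m choose m)"
  proof -
    have "fact m * fact m * (2 * m choose m) = (fact (2 * m) :: nat)"
      using binomial_fact_lemma[of m "2 * m"] by (simp add: mult_2)
    from arg_cong[OF this, of int] show ?thesis
      by (simp add: power2_eq_square)
  qed
  finally show ?thesis
    by simp
qed

section \<open>Valuations of factorials and binomial coefficients\<close>

lemma multiplicity_eq_card:
  fixes p x :: nat
  assumes p: "prime p" and x: "x > 0" "x \<le> K"
  shows "multiplicity p x = card {k \<in> {1..K}. p ^ k dvd x}"
proof -
  have iff: "p ^ k dvd x \<longleftrightarrow> k \<le> multiplicity p x" for k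
    using p x by (intro power_dvd_iff_le_multiplicity) auto
  have le: "multiplicity p x \<le> K"
  proof -
    have "multiplicity p x < p ^ multiplicity p x"
      using prime_ge_2_nat[OF p] by (intro less_exp[THEN less_le_trans] power_mono) auto
    also have "\<dots> \<le> x"
      using x by (intro dvd_imp_le multiplicity_dvd) auto
    finally show ?thesis
      using x by simp
  qed
  have "{k \<in> {1..K}. p ^ k dvd x} = {1..multiplicity p x}"
    unfolding iff using le order.trans by fastforce
  then show ?thesis
    by simp
qed

text \<open>Legendre's formula. The free bound \<open>K\<close> lets factorials of different numbers
  be compared summand by summand over one range.\<close>

lemma multiplicity_fact:
  fixes p n :: nat
  assumes p: "prime p" and n: "n \<le> K"
  shows "multiplicity p (fact n :: nat) = (\<Sum>k\<in>{1..K}. n div p ^ k)"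
  using n
proof (induction n)
  case (Suc n)
  have "multiplicity p (fact (Suc n) :: nat) = multiplicity p (Suc n) + multiplicity p (fact n :: nat)"
    unfolding fact_Suc of_nat_id using p
    by (intro prime_elem_multiplicity_mult_distrib) auto
  also have "multiplicity p (Suc n) = (\<Sum>k\<in>{1..K}. if p ^ k dvd Suc n then 1 else 0)"
    using multiplicity_eq_card[OF p _ Suc.prems] by (simp add: sum.If_cases Int_def)
  also have "(\<Sum>k\<in>{1..K}. if p ^ k dvd Suc n then 1 else 0) + multiplicity p (fact n :: nat) =
      (\<Sum>k\<in>{1..K}. Suc n div p ^ k)"
    using Suc by (simp add: sum.distrib[symmetric] div_Suc mod_eq_0_iff_dvd)
      (intro sum.cong; simp add: dvd_eq_mod_eq_0)
  finally show ?case .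
qed simp

text \<open>Comparison of carries modulo \<open>P\<close>: with residues \<open>w\<close>,
  \<open>a\<close>, \<open>b\<close> of \<open>m\<close>, \<open>i\<close>, \<open>j\<close>, a
  carry in \<open>2 * w\<close> must be matched by one in \<open>w + a\<close> or
  \<open>w + b\<close>. Otherwise \<open>2 * (w + a + b) + 1\<close> or
  \<open>2 * (w + a + b) + 3\<close> would be an odd multiple of \<open>P\<close> strictly between
  \<open>P\<close> and \<open>3 * P\<close>. If \<open>2 * (m + i + j) < P\<close>, all quotients on
  the left are zero.\<close>

lemma div_add_inequality:
  fixes P m i j :: nat
  assumes "P dvd 2 * (m + i + j) + 1 \<or> P dvd 2 * (m + i + j) + 3 \<or> 2 * (m + i + j) < P"
  shows "2 * m div P + i div P + j div P \<le> (m + i) div P + (m + j) div P"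
proof (cases "2 * (m + i + j) < P")
  case True
  then show ?thesis
    by simp
next
  case False
  then have dvd: "P dvd 2 * (m + i + j) + 1 \<or> P dvd 2 * (m + i + j) + 3"
    using assms by simp
  have "odd P"
  proof
    assume "even P"
    with dvd have "even (2 * (m + i + j) + 1) \<or> even (2 * (m + i + j) + 3)"
      using dvd_trans by blast
    then show False
      by simp
  qed
  then have "P > 0"
    by (auto intro: Nat.gr0I)
  define w a b where "w = m mod P" and "a = i mod P" and "b = j mod P"
  have lt: "w < P" "a < P" "b < P"
    using \<open>P > 0\<close> by (auto simp: w_def a_def b_def)
  have m: "m = P * (m div P) + w" and i: "i = P * (i div P) + a" and j: "j = P * (j div P) + b"
    by (simp_all add: w_def a_def b_def)
  have carry: "(P * u + r) div P = u + (if r < P then 0 else 1)" if "r < 2 * P" for u r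
  proof (cases "r < P")
    case False
    then have "P * u + r = (r - P) + P * (u + 1)" "r - P < P"
      using that by (auto simp: algebra_simps)
    then show ?thesis
      using False \<open>P > 0\<close> by (simp only: div_mult_self2) simp
  qed (use \<open>P > 0\<close> in simp)
  have split: "P * (2 * (m div P)) + 2 * w = 2 * m"
    "P * (m div P + i div P) + (w + a) = m + i" "P * (m div P + j div P) + (w + b) = m + j"
    using m i j by (auto simp: algebra_simps)
  have "2 * w < 2 * P" "w + a < 2 * P" "w + b < 2 * P"
    using lt by auto
  then have eqs: "2 * m div P = 2 * (m div P) + (if 2 * w < P then 0 else 1)"
    "(m + i) div P = m div P + i div P + (if w + a < P then 0 else 1)"
    "(m + j) div P = m div P + j div P + (if w + b < P then 0 else 1)"
    using carry[of "2 * w" "2 * (m div P)"] carry[of "w + a" "m div P + i div P"]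
      carry[of "w + b" "m div P + j div P"]
    by (simp_all only: split)
  have "P \<le> w + a \<or> P \<le> w + b" if "P \<le> 2 * w"
  proof (rule ccontr)
    assume "\<not> (P \<le> w + a \<or> P \<le> w + b)"
    then have ub: "w + a < P" "w + b < P"
      by auto
    have "P < 2 * w"
      using that \<open>odd P\<close> by (metis even_mult_iff even_numeral le_neq_implies_less)
    have "2 * (m + i + j) = P * (2 * (m div P + i div P + j div P)) + 2 * (w + a + b)"
      using m i j by (auto simp: algebra_simps)
    then have "2 * (m + i + j) + s = P * (2 * (m div P + i div P + j div P)) + (2 * (w + a + b) + s)" for s
      by simp
    then have "P dvd 2 * (w + a + b) + 1 \<or> P dvd 2 * (w + a + b) + 3"
      using dvd by (metis dvd_add_right_iff dvd_triv_left)
    then obtain s where s: "s = 1 \<or> s = (3::nat)" and "P dvd 2 * (w + a + b) + s"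
      by blast
    then obtain c where c: "2 * (w + a + b) + s = P * c"
      unfolding dvd_def by blast
    have "odd (P * c)"
      using s unfolding c[symmetric] by auto
    then have "odd c"
      by simp
    \<comment> \<open>Adding the bounds for \<open>w + a\<close> and \<open>w + b\<close> and using
      \<open>P < 2 * w\<close> gives \<open>2 * (w + a + b) \<le> 3 * P - 5\<close>, which leaves
      room for \<open>s \<le> 3\<close>.\<close>
    have "P * c < P * 3"
      unfolding c[symmetric] using s ub \<open>P < 2 * w\<close> by auto
    then have "c < 3"
      by simp
    with \<open>odd c\<close> have "c = 1"
      by (cases c rule: nat.exhaust) (auto simp: less_Suc_eq numeral_3_eq_3)
    with c \<open>P < 2 * w\<close> show False
      by simp
  qed
  then show ?thesis
    unfolding eqs by (cases "P \<le> 2 * w") auto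
qed

text \<open>After expanding in factorials the copies of \<open>m!\<close> cancel, and the claim is
  \<open>v(2 m) + v(i) + v(j) \<le> v(m + i) + v(m + j)\<close> with \<open>j = e - i\<close>.
  Legendre's formula reduces it to the inequality of quotients for each power of \<open>p\<close>;
  here \<open>m + i + j = d - 1\<close> explains the numbers \<open>2 * d - 1\<close> and
  \<open>2 * d + 1\<close>.\<close>

lemma multiplicity_binomial_inequality:
  fixes p d m e i :: nat
  assumes p: "prime p" and d: "d = Suc (m + e)" and i: "i \<le> e"
    and P: "\<And>k. p ^ k dvd 2 * d - 1 \<or> p ^ k dvd 2 * d + 1 \<or> 2 * (d - 1) < p ^ k"
  shows "multiplicity p (2 * m choose m) \<le>
    multiplicity p (((m + i) choose m) * ((m + (e - i)) choose m))"
proof -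
  define j where "j = e - i"
  define K where "K = 2 * (m + e)"
  define v where "v x = multiplicity p (fact x :: nat)" for x
  have v: "v x = (\<Sum>k\<in>{1..K}. x div p ^ k)" if "x \<le> K" for x
    unfolding v_def by (rule multiplicity_fact[OF p that])
  have binom: "v a + v b + multiplicity p ((a + b) choose a) = v (a + b)" for a b
  proof -
    have "fact a * fact b * ((a + b) choose a) = (fact (a + b) :: nat)"
      using binomial_fact_lemma[of a "a + b"] by simp
    then have "v (a + b) = multiplicity p (fact a * fact b * ((a + b) choose a) :: nat)"
      by (simp add: v_def)
    also have "\<dots> = v a + v b + multiplicity p ((a + b) choose a)"
      unfolding v_def using p
      by (simp add: prime_elem_multiplicity_mult_distrib)
    finally show ?thesis
      by simp
  qed
  have "(\<Sum>k\<in>{1..K}. 2 * m div p ^ k + i div p ^ k + j div p ^ k) \<le>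
      (\<Sum>k\<in>{1..K}. (m + i) div p ^ k + (m + j) div p ^ k)"
  proof (rule sum_mono)
    fix k
    have "m + i + j = d - 1" "2 * (m + i + j) + 1 = 2 * d - 1" "2 * (m + i + j) + 3 = 2 * d + 1"
      using i d by (auto simp: j_def)
    with P[of k] show "2 * m div p ^ k + i div p ^ k + j div p ^ k \<le> (m + i) div p ^ k + (m + j) div p ^ k"
      by (intro div_add_inequality) metis
  qed
  then have "v (2 * m) + v i + v j \<le> v (m + i) + v (m + j)"
    using i by (simp add: v K_def j_def sum.distrib)
  moreover have "v m + v m + multiplicity p (2 * m choose m) = v (2 * m)"
    using binom[of m m] by (simp add: mult_2)
  moreover have "multiplicity p (((m + i) choose m) * ((m + j) choose m)) =
      multiplicity p ((m + i) choose m) + multiplicity p ((m + j) choose m)"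
    using p by (intro prime_elem_multiplicity_mult_distrib) auto
  ultimately show ?thesis
    using binom[of m i] binom[of m j] unfolding j_def by linarith
qed

text \<open>All coefficients in the integral convolution identity are divisible by the exact power
  of \<open>p\<close> in \<open>C(2 m, m)\<close>. Dividing by that power and reducing modulo
  \<open>p\<close> leaves a unit \<open>u\<close> on the right.\<close>

lemma convolution_mod_p:
  fixes d m e :: nat
  assumes p: "prime CHAR('k::field)" and d: "d = Suc (m + e)"
    and P: "\<And>k. CHAR('k::field) ^ k dvd 2 * d - 1 \<or> CHAR('k) ^ k dvd 2 * d + 1 \<or>
      2 * (d - 1) < CHAR('k) ^ k"
  obtains u :: "'k::field" and b :: "nat \<Rightarrow> 'k" where "u \<noteq> 0"
    "\<forall>k\<le>e. (\<Sum>i\<le>e. \<Sum>j\<le>2 * m.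
       if i + j = m + k then b i * of_nat (2 * m choose j) else 0) = (-1) ^ k * u"
proof -
  let ?p = "CHAR('k)"
  define v where "v = multiplicity ?p (2 * m choose m)"
  obtain u where u: "(2 * m choose m) = ?p ^ v * u" "\<not> ?p dvd u"
    using multiplicity_decompose'[of "2 * m choose m" ?p] p unfolding v_def
    by (metis binomial_eq_0_iff le_add2 mult_2 not_prime_unit not_less)
  have "?p ^ v dvd ((m + i) choose m) * ((m + (e - i)) choose m)" if "i \<le> e" for i
    using multiplicity_binomial_inequality[OF p d that P] p
    by (subst power_dvd_iff_le_multiplicity) (auto simp: v_def)
  then have "\<forall>i. \<exists>c. i \<le> e \<longrightarrow> ((m + i) choose m) * ((m + (e - i)) choose m) = ?p ^ v * c"
    unfolding dvd_def by blast
  then obtain c where c: "\<And>i. i \<le> e \<Longrightarrow>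
      ((m + i) choose m) * ((m + (e - i)) choose m) = ?p ^ v * c i"
    by metis
  have int_id: "(\<Sum>i\<le>e. \<Sum>j\<le>2 * m. if i + j = m + k
      then (-1) ^ i * int (c i) * int (2 * m choose j) else 0) = (-1) ^ k * int u"
    if "k \<le> e" for k
  proof -
    have "int (?p ^ v) * (\<Sum>i\<le>e. \<Sum>j\<le>2 * m. if i + j = m + k
        then (-1) ^ i * int (c i) * int (2 * m choose j) else 0) =
      (\<Sum>i\<le>e. \<Sum>j\<le>2 * m. if i + j = m + k
        then (-1) ^ i * int ((m + i) choose m) * int ((m + (e - i)) choose m) * int (2 * m choose j)
        else 0)"
      unfolding sum_distrib_left
    proof (intro sum.cong refl)
      fix i j assume "i \<in> {..e}"
      then have "int ((m + i) choose m) * int ((m + (e - i)) choose m) = int (?p ^ v) * int (c i)"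
        using c by (metis atMost_iff of_nat_mult)
      then show "int (?p ^ v) * (if i + j = m + k
          then (-1) ^ i * int (c i) * int (2 * m choose j) else 0) = (if i + j = m + k
          then (-1) ^ i * int ((m + i) choose m) * int ((m + (e - i)) choose m) * int (2 * m choose j)
          else 0)"
        by (simp add: mult.assoc[symmetric])
    qed
    also have "\<dots> = int (?p ^ v) * ((-1) ^ k * int u)"
      using alternating_binomial_convolution[OF that, of m] u(1) by (simp add: algebra_simps)
    finally show ?thesis
      using p prime_gt_0_nat[OF p] by simp
  qed
  show thesis
  proof
    show "of_nat u \<noteq> (0 :: 'k)"
      using u(2) by (simp add: of_nat_eq_0_iff_char_dvd)
    have "(\<Sum>i\<le>e. \<Sum>j\<le>2 * m. if i + j = m + k
        then ((-1) ^ i * of_nat (c i)) * of_nat (2 * m choose j) else 0) = (-1) ^ k * (of_nat u :: 'k)"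
      if "k \<le> e" for k
      using arg_cong[OF int_id[OF that], of "of_int :: int \<Rightarrow> 'k"]
      by (simp add: if_distrib[of "of_int :: int \<Rightarrow> 'k"] cong: if_cong)
    then show "\<forall>k\<le>e. (\<Sum>i\<le>e. \<Sum>j\<le>2 * m. if i + j = m + k
        then ((-1) ^ i * of_nat (c i)) * of_nat (2 * m choose j) else 0) = (-1) ^ k * (of_nat u :: 'k)"
      by blast
  qed
qed

section \<open>Two variables\<close>

definition bi :: "nat \<Rightarrow> nat \<Rightarrow> nat \<Rightarrow>\<^sub>0 nat" where
  "bi a b = exponent_of 1 (\<lambda>i. if i = 0 then a else b)"

lemma lookup_bi [simp]: "lookup (bi a b) 0 = a" "lookup (bi a b) (Suc 0) = b"
  by (simp_all add: bi_def lookup_exponent_of)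

lemma bi_exponents [simp]: "bi a b \<in> exponents (Suc 0)"
  using exponent_of_in[of 1] by (simp add: bi_def)

lemma bi_eq_iff: "bi a b = bi a' b' \<longleftrightarrow> a = a' \<and> b = b'"
  by (metis lookup_bi)

lemma bi_eqI: "m \<in> exponents (Suc 0) \<Longrightarrow> m = bi (lookup m 0) (lookup m (Suc 0))"
  by (rule exponents_eqI) (auto simp: le_Suc_eq)

lemma monom_deg_bi [simp]: "monom_deg (bi a b) = a + b"
  by (simp add: monom_deg_eq[OF bi_exponents])

lemma bi_add: "bi a b + bi a' b' = bi (a + a') (b + b')"
  by (rule exponents_eqI[of _ "Suc 0", OF exponents_add]) (auto simp: lookup_add le_Suc_eq)

lemma bi_large_iff: "bi a b \<in> large_exponents (Suc 0) d \<longleftrightarrow> d \<le> a \<or> d \<le> b"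
proof -
  have "(\<exists>i\<le>Suc 0. d \<le> lookup (bi a b) i) \<longleftrightarrow>
      d \<le> lookup (bi a b) 0 \<or> d \<le> lookup (bi a b) (Suc 0)"
    by (metis le_Suc_eq le_zero_eq order_refl zero_le)
  then show ?thesis
    by (simp add: large_exponents_def)
qed

lemma Var_power_bi:
  "(Var 0 :: 'k::field mpoly) ^ a * Var (Suc 0) ^ b = single (bi a b) 1"
proof -
  have "single 0 a + single (Suc 0) b = bi a b"
    by (rule exponents_eqI[of _ "Suc 0", OF exponents_add])
      (auto simp: lookup_add lookup_single le_Suc_eq exponents_single)
  then show ?thesis
    by (simp add: Var_power mult_single)
qed

lemma var_sum_power:
  "(var_sum (Suc 0) :: 'k::field mpoly) ^ N = (\<Sum>j\<le>N. single (bi j (N - j)) (of_nat (N choose j)))"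
proof -
  have "(var_sum (Suc 0) :: 'k mpoly) ^ N =
      (\<Sum>j\<le>N. of_nat (N choose j) * (Var 0 ^ j * Var (Suc 0) ^ (N - j)))"
    by (simp add: var_sum_def binomial_ring mult.assoc)
  also have "\<dots> = (\<Sum>j\<le>N. single (bi j (N - j)) (of_nat (N choose j)))"
    unfolding Var_power_bi
    by (intro sum.cong refl) (simp add: mult_single flip: single_of_nat)
  finally show ?thesis .
qed

lemma lookup_var_sum_mult:
  "lookup (var_sum (Suc 0) * h) (bi (Suc a) (Suc b)) =
     lookup h (bi a (Suc b)) + lookup (h :: 'k::field mpoly) (bi (Suc a) b)"
proof -
  have "var_sum (Suc 0) * h = h * single (bi 1 0) 1 + h * single (bi 0 1) 1"
    using Var_power_bi[of 1 0, where 'k = 'k] Var_power_bi[of 0 1, where 'k = 'k]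
    by (simp add: var_sum_def algebra_simps)
  moreover have "lookup (h * single (bi 1 0) 1) (bi (Suc a) (Suc b)) = lookup h (bi a (Suc b))"
    using lookup_mult_single[of h "bi 1 0" 1 "bi a (Suc b)"] by (simp add: bi_add)
  moreover have "lookup (h * single (bi 0 1) 1) (bi (Suc a) (Suc b)) = lookup h (bi (Suc a) b)"
    using lookup_mult_single[of h "bi 0 1" 1 "bi (Suc a) b"] by (simp add: bi_add)
  ultimately show ?thesis
    by (simp add: lookup_add)
qed

text \<open>Outside the ideal the monomials of this degree form a chain indexed by
  \<open>k \<le> e\<close>. The vanishing of \<open>var_sum * h\<close> at the monomial joining two
  neighbours forces opposite coefficients, so \<open>h\<close> is determined modulo the ideal by one
  of them.\<close>

lemma kernel_var_sum:
  fixes h :: "'k::field mpoly"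
  assumes lh: "var_sum (Suc 0) * h \<in> monomial_ci (Suc 0) d" and d: "d = Suc (m + e)" and k: "k \<le> e"
  shows "lookup h (bi (m + k) (d - 1 - k)) = (-1) ^ k * lookup h (bi m (d - 1))"
  using k
proof (induction k)
  case (Suc k)
  define b where "b = d - 2 - k"
  have b: "d - 1 - k = Suc b" "d - 1 - Suc k = b"
    using Suc.prems d by (auto simp: b_def)
  have "bi (Suc (m + k)) (Suc b) \<notin> large_exponents (Suc 0) d"
    using Suc.prems d by (auto simp: bi_large_iff b_def)
  then have "lookup (var_sum (Suc 0) * h) (bi (Suc (m + k)) (Suc b)) = 0"
    using lh by (auto simp: monomial_ci_eq in_keys_iff)
  then have "lookup h (bi (m + Suc k) b) = - lookup h (bi (m + k) (Suc b))"
    by (simp add: lookup_var_sum_mult add_eq_0_iff)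
  with Suc b show ?case
    by simp
qed simp

lemma lefschetz_two_variables:
  assumes p: "prime CHAR('k::field)" and d: "d \<ge> 1"
    and P: "\<And>k. CHAR('k::field) ^ k dvd 2 * d - 1 \<or> CHAR('k) ^ k dvd 2 * d + 1 \<or>
      2 * (d - 1) < CHAR('k) ^ k"
  shows "lefschetz_element (Suc 0) d (var_sum (Suc 0) :: 'k::field mpoly)"
proof (rule lefschetz_criterion[OF d var_sum_homogeneous])
  let ?l = "var_sum (Suc 0) :: 'k mpoly"
  fix e and h :: "'k mpoly"
  assume e: "2 * e \<le> (Suc 0 + 1) * (d - 1)"
    and h: "h \<in> homogeneous (Suc 0) (int ((Suc 0 + 1) * (d - 1) - e))"
    and lh: "?l * h \<in> monomial_ci (Suc 0) d"
  define m where "m = d - 1 - e"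
  have dm: "d = Suc (m + e)"
    using e d by (simp add: m_def)
  have deg: "(Suc 0 + 1) * (d - 1) - e = 2 * m + e" "(Suc 0 + 1) * (d - 1) - 2 * e = 2 * m"
    using dm by auto
  obtain u :: 'k and b :: "nat \<Rightarrow> 'k" where u: "u \<noteq> 0" and conv:
    "\<forall>k\<le>e. (\<Sum>i\<le>e. \<Sum>j\<le>2 * m.
       if i + j = m + k then b i * of_nat (2 * m choose j) else 0) = (-1) ^ k * u"
    by (rule convolution_mod_p[OF p dm P])
  \<comment> \<open>Scales the universal preimage so that the first coefficient of the chain agrees
    with that of \<open>h\<close>; the others then agree by the alternating signs.\<close>
  define s where "s = lookup h (bi m (d - 1)) / u"
  define f where "f = (\<Sum>i\<le>e. single (bi i (e - i)) (s * b i))"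
  have f: "f \<in> homogeneous (Suc 0) (int e)"
    unfolding f_def by (rule homogeneous_sum) (auto simp: homogeneous_eq)
  have prod: "?l ^ (2 * m) * f =
      (\<Sum>i\<le>e. \<Sum>j\<le>2 * m. single (bi (i + j) (e - i + (2 * m - j))) (s * b i * of_nat (2 * m choose j)))"
    unfolding var_sum_power f_def mult.commute[of "sum _ {..2 * m}"]
    by (simp only: sum_product mult_single bi_add)
  have "h - ?l ^ (2 * m) * f \<in> monomial_ci (Suc 0) d"
    unfolding monomial_ci_eq
  proof (safe, rule ccontr)
    fix x assume x: "x \<in> keys (h - ?l ^ (2 * m) * f)" and small: "x \<notin> large_exponents (Suc 0) d"
    have "?l ^ (2 * m) * f \<in> homogeneous (Suc 0) (int (2 * m) * 1 + int e)"
      by (intro homogeneous_times homogeneous_power var_sum_homogeneous f)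
    then have "h - ?l ^ (2 * m) * f \<in> homogeneous (Suc 0) (int (2 * m + e))"
      using h unfolding deg by (intro homogeneous_closed) auto
    then have xexp: "x \<in> exponents (Suc 0)" and xdeg: "monom_deg x = 2 * m + e"
      using x by (auto simp: homogeneous_eq)
    define k where "k = lookup x 0 - m"
    have "lookup x 0 < d" "lookup x (Suc 0) < d"
      using small xexp by (auto simp: large_exponents_def not_le)
    moreover have "lookup x 0 + lookup x (Suc 0) = 2 * m + e"
      using xdeg xexp by (simp add: monom_deg_eq)
    ultimately have k: "k \<le> e" "lookup x 0 = m + k" "lookup x (Suc 0) = d - 1 - k"
      using dm by (auto simp: k_def)
    have xbi: "x = bi (m + k) (d - 1 - k)"
      using bi_eqI[OF xexp] k by simp
    have "lookup (?l ^ (2 * m) * f) x = (\<Sum>i\<le>e. \<Sum>j\<le>2 * m.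
        s * (if i + j = m + k then b i * of_nat (2 * m choose j) else 0))"
      unfolding prod xbi lookup_sum using dm k(1)
      by (intro sum.cong refl) (auto simp: lookup_single when_def bi_eq_iff)
    also have "\<dots> = s * ((-1) ^ k * u)"
      by (simp only: sum_distrib_left[symmetric] conv[rule_format, OF k(1)])
    also have "\<dots> = lookup h x"
      unfolding xbi kernel_var_sum[OF lh dm k(1)] s_def using u by simp
    finally show False
      using x by (simp add: in_keys_iff lookup_minus)
  qed
  with f show "\<exists>f\<in>homogeneous (Suc 0) (int e).
      h - ?l ^ ((Suc 0 + 1) * (d - 1) - 2 * e) * f \<in> monomial_ci (Suc 0) d"
    unfolding deg by blast
qed

section \<open>Divisibility conditions on d\<close>

text \<open>Two instances of the failure criterion for the division
  \<open>d = q * c + \<rho>\<close>: either \<open>c\<close> and \<open>\<rho>\<close> themselves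
  with \<open>B = q * c - 1\<close>, or quotient \<open>c + 1\<close> and shift \<open>0\<close>
  with \<open>B = d - 1\<close>. The two inequalities are the respective degree bounds.\<close>

lemma not_lefschetz_digits:
  fixes l :: "'k::field mpoly" and c q r \<rho> d n :: nat
  assumes p: "prime CHAR('k)" and q: "q = CHAR('k) ^ r" and l: "l \<in> homogeneous n 1"
    and d: "d = q * c + \<rho>" "d \<ge> 1" "\<rho> < q"
    and or: "(c \<ge> 1 \<and> q \<le> (n + 1) * (q - 1 - \<rho>)) \<or> (\<rho> \<ge> 1 \<and> q \<le> (n + 1) * (\<rho> - 1))"
  shows "\<not> lefschetz_element n d l"
  using or
proof (elim disjE conjE)
  assume c: "c \<ge> 1" and q_le: "q \<le> (n + 1) * (q - 1 - \<rho>)"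
  obtain c' where c': "c = Suc c'"
    using c by (cases c) auto
  \<comment> \<open>So \<open>z\<close> is \<open>q - 1 - \<rho>\<close>, written without
    subtraction.\<close>
  obtain z where z: "q = Suc (\<rho> + z)"
    using d(3) less_imp_Suc_add by blast
  have "q * ((n + 1) * c' + 1) + (n + 1) * \<rho> \<le> q * ((n + 1) * c') + ((n + 1) * z + (n + 1) * \<rho>)"
    using q_le z by (simp add: algebra_simps)
  also have "\<dots> = (n + 1) * (q * c - 1)"
    using z c' by (simp add: algebra_simps)
  finally show ?thesis
    using d c c' z by (intro not_lefschetz_element[OF p q l, of c d \<rho> "q * c - 1"]) auto
next
  assume \<rho>: "\<rho> \<ge> 1" and q_le: "q \<le> (n + 1) * (\<rho> - 1)"
  obtain z where z: "\<rho> = Suc z"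
    using \<rho> by (cases \<rho>) auto
  have "q * ((n + 1) * c + 1) \<le> (n + 1) * (d - 1)"
    using q_le z d by (simp add: algebra_simps)
  then show ?thesis
    using d \<rho> by (intro not_lefschetz_element[OF p q l, of "Suc c" d 0 "d - 1"]) auto
qed

text \<open>For the least power \<open>q\<close> of 2 with \<open>d \<le> q\<close>, the power
  \<open>l ^ q\<close> lies in the ideal, while \<open>q \<le> 2 * (d - 1)\<close> keeps the
  component of degree \<open>q\<close> nonzero. So multiplication by \<open>l ^ q\<close> from
  degree \<open>0\<close> is neither injective nor surjective.\<close>

lemma not_lefschetz_char_2:
  fixes l :: "'k::field mpoly"
  assumes char: "CHAR('k) = 2" and l: "l \<in> homogeneous n 1" and d: "d \<ge> 2" and n: "n \<ge> 1"
  shows "\<not> lefschetz_element n d l"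
proof -
  define r where "r = (LEAST r. d \<le> 2 ^ r)"
  have "d \<le> 2 ^ d"
    using less_exp[of d] by simp
  then have r: "d \<le> 2 ^ r"
    unfolding r_def by (rule LeastI)
  then obtain r' where r': "r = Suc r'"
    using d by (cases r) auto
  then have "2 ^ r' < d"
    using not_less_Least[of r' "\<lambda>r. d \<le> 2 ^ r"] by (simp add: r_def[symmetric] not_le)
  then have "2 ^ r \<le> 2 * (d - 1)"
    by (simp add: r')
  also have "\<dots> \<le> (n + 1) * (d - 1)"
    using n by (intro mult_right_mono) auto
  finally show ?thesis
    using r d char by (intro not_lefschetz_element[of "2 ^ r" r l n 1 d 0 "d - 1"]) (auto simp: l)
qed

text \<open>Division of \<open>d\<close> by the characteristic itself suffices: with at least three
  variables, \<open>3 * (q - 1 - \<rho>)\<close> or \<open>3 * (\<rho> - 1)\<close> reaches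
  \<open>q\<close>, according to whether \<open>\<rho>\<close> is below or above
  \<open>q / 2\<close>. If the quotient is zero, then \<open>\<rho> = d\<close> and the assumed
  bound is the second condition.\<close>

lemma not_lefschetz_small_char:
  fixes l :: "'k::field mpoly"
  assumes p: "prime CHAR('k)" and l: "l \<in> homogeneous n 1" and d: "d \<ge> 2" and n: "n \<ge> 2"
    and le: "CHAR('k) \<le> (n + 1) * (d - 1)"
  shows "\<not> lefschetz_element n d l"
proof (cases "CHAR('k) = 2")
  case True
  then show ?thesis
    using not_lefschetz_char_2[OF True l d] n by simp
next
  case False
  define q where "q = CHAR('k)"
  have q3: "q \<ge> 3" and "odd q"
    using p False prime_ge_2_nat[OF p] prime_odd_nat[OF p] by (auto simp: q_def)
  define c \<rho> where "c = d div q" and "\<rho> = d mod q"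
  have dq: "d = q * c + \<rho>" "\<rho> < q"
    using q3 by (auto simp: c_def \<rho>_def)
  have mono: "3 * x \<le> (n + 1) * x" for x
    using n by (intro mult_right_mono) auto
  have "(c \<ge> 1 \<and> q \<le> (n + 1) * (q - 1 - \<rho>)) \<or> (\<rho> \<ge> 1 \<and> q \<le> (n + 1) * (\<rho> - 1))"
  proof (cases "c = 0")
    case True
    then show ?thesis
      using dq d le by (simp add: q_def)
  next
    case nz: False
    show ?thesis
    proof (cases "2 * \<rho> < q")
      case True
      then have "q \<le> 3 * (q - 1 - \<rho>)"
        using q3 by linarith
      with mono[of "q - 1 - \<rho>"] nz show ?thesis
        by linarith
    next
      case False
      then have "2 * \<rho> > q"
        using \<open>odd q\<close> by (metis even_mult_iff even_numeral linorder_neqE_nat)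
      then have "q \<le> 3 * (\<rho> - 1)" "\<rho> \<ge> 1"
        using q3 by linarith+
      with mono[of "\<rho> - 1"] show ?thesis
        by linarith
    qed
  qed
  then show ?thesis
    using dq d by (intro not_lefschetz_digits[OF p _ l, of q 1 d c \<rho>]) (auto simp: q_def)
qed

text \<open>With two variables the failure conditions miss only \<open>2 * \<rho> = q - 1\<close>
  and \<open>2 * \<rho> = q + 1\<close>, which mean that \<open>q\<close> divides
  \<open>2 * d + 1\<close> and \<open>2 * d - 1\<close> respectively.\<close>

lemma lefschetz_two_variables_dvd:
  fixes l :: "'k::field mpoly"
  assumes p: "prime CHAR('k)" "CHAR('k) \<noteq> 2" and l: "l \<in> homogeneous 1 1" and d: "d \<ge> 2"
    and le: "CHAR('k) ^ r \<le> 2 * (d - 1)" and lef: "lefschetz_element 1 d l"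
  shows "CHAR('k) ^ r dvd 2 * d - 1 \<or> CHAR('k) ^ r dvd 2 * d + 1"
proof (rule ccontr)
  define q where "q = CHAR('k) ^ r"
  assume "\<not> ?thesis"
  then have ndvd: "\<not> q dvd 2 * d - 1" "\<not> q dvd 2 * d + 1"
    by (simp_all add: q_def)
  have "odd q"
    using p prime_odd_nat[OF p(1)] prime_ge_2_nat[OF p(1)] by (auto simp: q_def)
  then have "q > 0"
    by (auto intro: Nat.gr0I)
  define c \<rho> where "c = d div q" and "\<rho> = d mod q"
  have dq: "d = q * c + \<rho>" "\<rho> < q"
    using \<open>q > 0\<close> by (auto simp: c_def \<rho>_def)
  have ne: "2 * \<rho> + 1 \<noteq> q" "2 * \<rho> \<noteq> q + 1"
  proof
    assume "2 * \<rho> + 1 = q"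
    then have "2 * d + 1 = q * (2 * c + 1)"
      using dq by (simp add: algebra_simps)
    then show False
      using ndvd by simp
  next
    show "2 * \<rho> \<noteq> q + 1"
    proof
      assume "2 * \<rho> = q + 1"
      then have "2 * d - 1 = q * (2 * c + 1)"
        using dq by (simp add: algebra_simps)
      then show False
        using ndvd by simp
    qed
  qed
  have "(c \<ge> 1 \<and> q \<le> 2 * (q - 1 - \<rho>)) \<or> (\<rho> \<ge> 1 \<and> q \<le> 2 * (\<rho> - 1))"
  proof (cases "2 * \<rho> < q")
    case True
    then have *: "2 * \<rho> + 3 \<le> q"
      using ne \<open>odd q\<close> by presburger
    then have "q \<le> 2 * (q - 1 - \<rho>)"
      by linarith
    \<comment> \<open>A zero quotient means \<open>\<rho> = d\<close>, and then
      \<open>q \<le> 2 * (d - 1)\<close> contradicts \<open>2 * \<rho> + 3 \<le> q\<close>.\<close>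
    moreover have "c \<noteq> 0"
    proof
      assume "c = 0"
      then show False
        using * le dq by (simp add: q_def)
    qed
    ultimately show ?thesis
      by linarith
  next
    case False
    then have "2 * \<rho> \<ge> q + 3"
      using ne \<open>odd q\<close> by presburger
    then show ?thesis
      by linarith
  qed
  then have "\<not> lefschetz_element 1 d l"
    using dq d by (intro not_lefschetz_digits[OF p(1) _ l, of q r d c \<rho>]) (auto simp: q_def)
  with lef show False
    by blast
qed

section \<open>The exponent \<open>s\<close> and the final equivalence\<close>

lemma Greatest_prime_power:
  fixes p M :: nat
  assumes p: "prime p" and M: "M > 0"
  defines "s \<equiv> GREATEST s. s \<ge> 1 \<and> p ^ (s - 1) dvd M"
  shows "s \<ge> 1" "p ^ (s - 1) dvd M" "\<not> p ^ s dvd M"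
proof -
  have bound: "y \<le> Suc M" if "y \<ge> 1 \<and> p ^ (y - 1) dvd M" for y
  proof -
    have "y - 1 < 2 ^ (y - 1)"
      by simp
    also have "\<dots> \<le> p ^ (y - 1)"
      using prime_ge_2_nat[OF p] by (intro power_mono) auto
    also have "\<dots> \<le> M"
      using that M by (intro dvd_imp_le) auto
    finally show ?thesis
      by simp
  qed
  have "s \<ge> 1 \<and> p ^ (s - 1) dvd M"
    unfolding s_def
    by (rule GreatestI_nat[of "\<lambda>s. s \<ge> 1 \<and> p ^ (s - 1) dvd M" 1 "Suc M"]) (use bound in auto)
  then show "s \<ge> 1" "p ^ (s - 1) dvd M"
    by auto
  show "\<not> p ^ s dvd M"
  proof
    assume "p ^ s dvd M"
    then have "Suc s \<le> s"
      using bound unfolding s_def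
      by (intro Greatest_le_nat[of "\<lambda>s. s \<ge> 1 \<and> p ^ (s - 1) dvd M"]) auto
    then show False
      by simp
  qed
qed

text \<open>The two odd factors differ by 2, so a prime divides at most one of them and the whole
  power must divide the other factor or that one.\<close>

lemma prime_power_dvd_consecutive_odd:
  fixes p d k :: nat
  assumes p: "prime p" and dvd: "p ^ k dvd (2 * d - 1) * (2 * d + 1)" and d: "d \<ge> 1"
  shows "p ^ k dvd 2 * d - 1 \<or> p ^ k dvd 2 * d + 1"
proof (cases "p dvd 2 * d - 1")
  case False
  then have "coprime (p ^ k) (2 * d - 1)"
    using p by (simp add: prime_imp_coprime)
  with dvd show ?thesis
    by (metis coprime_dvd_mult_right_iff)
next
  case True
  have "\<not> p dvd 2 * d + 1"
  proof
    assume "p dvd 2 * d + 1"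
    then have "p dvd (2 * d + 1) - (2 * d - 1)"
      using True by (rule dvd_diff_nat)
    also have "(2 * d + 1) - (2 * d - 1) = 2"
      using d by linarith
    finally have "p = 2"
      using primes_dvd_imp_eq[OF p two_is_prime_nat] by blast
    with True d show False
      by simp
  qed
  then have "coprime (p ^ k) (2 * d + 1)"
    using p by (simp add: prime_imp_coprime)
  with dvd show ?thesis
    by (metis coprime_dvd_mult_left_iff)
qed

theorem theorem7p2:
  fixes d n p :: nat
  assumes "d \<ge> 2" and "n \<ge> 1"
    and "infinite (UNIV :: 'k::field set)"
    and "CHAR('k) = p"
  shows "strong_lefschetz n (monomial_ci n d :: 'k mpoly set) \<longleftrightarrow>
    p = 0 \<or>
    (prime p \<and>
      ((n = 1 \<and>
        p ^ (GREATEST s. s \<ge> 1 \<and> p ^ (s - 1) dvd (2 * d - 1) * (2 * d + 1)) > 2 * (d - 1)) \<or>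
       (n \<ge> 2 \<and> p > (n + 1) * (d - 1))))"
proof -
  note d = assms(1) and n = assms(2) and char = assms(4)
  define M where "M = (2 * d - 1) * (2 * d + 1)"
  define s where "s = (GREATEST s. s \<ge> 1 \<and> p ^ (s - 1) dvd M)"
  have "M > 0" "odd M"
    using d by (auto simp: M_def)
  have large: "strong_lefschetz n (monomial_ci n d :: 'k mpoly set)"
    if "p = 0 \<or> p > (n + 1) * (d - 1)"
  proof -
    have "of_nat j \<noteq> (0 :: 'k)" if "1 \<le> j" "j \<le> (n + 1) * (d - 1)" for j
      using that \<open>p = 0 \<or> _\<close> char by (auto simp: of_nat_eq_0_iff_char_dvd dest: dvd_imp_le)
    then have "lefschetz_element n d (var_sum n :: 'k mpoly)"
      using d by (intro lefschetz_large_char) auto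
    then show ?thesis
      unfolding strong_lefschetz_iff using var_sum_homogeneous by blast
  qed
  show ?thesis
  proof (cases "p = 0")
    case True
    then show ?thesis
      using large by simp
  next
    case False
    then have p: "prime p"
      using char prime_CHAR_semidom[where 'a = 'k] by simp
    note s = Greatest_prime_power[OF p \<open>M > 0\<close>, folded s_def]
    have odd_if: "p \<noteq> 2" if "p ^ s > 2 * (d - 1)"
    proof
      assume "p = 2"
      with s \<open>odd M\<close> have "s = 1"
        by (metis One_nat_def Suc_leI diff_is_0_eq dvd_trans dvd_power le_antisym not_less
            zero_less_diff)
      with that \<open>p = 2\<close> d show False
        by simp
    qed
    have one: "strong_lefschetz 1 (monomial_ci 1 d :: 'k mpoly set) \<longleftrightarrow> p ^ s > 2 * (d - 1)"
    proof
      assume "strong_lefschetz 1 (monomial_ci 1 d :: 'k mpoly set)"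
      then obtain l :: "'k mpoly" where l: "l \<in> homogeneous 1 1" "lefschetz_element 1 d l"
        unfolding strong_lefschetz_iff by blast
      have "p \<noteq> 2"
        using not_lefschetz_char_2[OF _ l(1) d] l(2) char by auto
      show "p ^ s > 2 * (d - 1)"
      proof (rule ccontr)
        assume "\<not> p ^ s > 2 * (d - 1)"
        \<comment> \<open>Every power of \<open>p\<close> up to \<open>2 * (d - 1)\<close> divides
          one of the two odd factors; for \<open>p ^ s\<close> this contradicts the maximality of
          \<open>s\<close>.\<close>
        then have "p ^ s dvd 2 * d - 1 \<or> p ^ s dvd 2 * d + 1"
          using lefschetz_two_variables_dvd[OF _ _ l(1) d _ l(2), of s] p \<open>p \<noteq> 2\<close> char by simp
        then have "p ^ s dvd M"
          unfolding M_def using dvd_mult dvd_mult2 by blast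
        with s(3) show False
          by blast
      qed
    next
      assume gt: "p ^ s > 2 * (d - 1)"
      have "p ^ k dvd 2 * d - 1 \<or> p ^ k dvd 2 * d + 1 \<or> 2 * (d - 1) < p ^ k" for k
      \<comment> \<open>Below \<open>s\<close> the power divides \<open>M\<close>, hence one of its
        two factors; from \<open>s\<close> on it is at least \<open>p ^ s\<close> and thus exceeds
        \<open>2 * (d - 1)\<close>.\<close>
      proof (cases "k < s")
        case True
        then have "p ^ k dvd p ^ (s - 1)"
          by (intro le_imp_power_dvd) simp
        then have "p ^ k dvd (2 * d - 1) * (2 * d + 1)"
          using s(2) unfolding M_def by (rule dvd_trans)
        from prime_power_dvd_consecutive_odd[OF p this] d show ?thesis
          by linarith
      next
        case False
        then have "p ^ s \<le> p ^ k"
          using prime_gt_0_nat[OF p] by (intro power_increasing) auto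
        with gt show ?thesis
          by linarith
      qed
      then have "lefschetz_element 1 d (var_sum 1 :: 'k mpoly)"
        using lefschetz_two_variables[where 'k = 'k and d = d] p d char by simp
      then show "strong_lefschetz 1 (monomial_ci 1 d :: 'k mpoly set)"
        unfolding strong_lefschetz_iff using var_sum_homogeneous by blast
    qed
    have two: "strong_lefschetz n (monomial_ci n d :: 'k mpoly set) \<longleftrightarrow> p > (n + 1) * (d - 1)"
      if "n \<ge> 2"
    proof
      assume "strong_lefschetz n (monomial_ci n d :: 'k mpoly set)"
      then obtain l :: "'k mpoly" where "l \<in> homogeneous n 1" "lefschetz_element n d l"
        unfolding strong_lefschetz_iff by blast
      with not_lefschetz_small_char[of l n d] p char d that show "p > (n + 1) * (d - 1)"
        using not_le by blast
    qed (use large in blast)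
    show ?thesis
      unfolding M_def[symmetric] s_def[symmetric]
      using one two False p n by (cases "n = 1") auto
  qed
qed

end
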